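(* Fix a real number $\lambda > 1$. Let $p = 2^k n - 1$ where $k \geq 2$ is an integer and $n$ is an odd positive integer with $n \leq \sqrt{p}/\lambda$, and assume $\lambda\sqrt{p} > (p^{1/4}+1)^2$. Let $m$ be an integer that is a quadratic non-residue modulo $p$, and let $E$ be the curve $y^2 = x^3 - mx$. Then $p$ is prime if and only if there exists a point $Q = (x,y)$ on $E$ (with coordinates in $\mathbb{Z}/p\mathbb{Z}$) such that, for the sequence $S_i$ with initial value $S_0 = x$, \[ \gcd(S_i, p) = 1 \text{ for } i = 1, 2, \ldots, k-1, \qquad \text{and} \qquad S_k \equiv 0 \pmod p. \]
   Context: The sequence $S_i$ with initial value $x$ is defined as follows. Put $x_0 = x$ and $S_0 = x$. For $i \geq 1$, set $S_i = 4(x_{i-1}^3 - m x_{i-1})$, and, when $S_i$ is invertible modulo $p$, set $x_i = \dfrac{x_{i-1}^4 + 2m x_{i-1}^2 + m^2}{4(x_{i-1}^3 - m x_{i-1})} \bmod p$. Thus $x_i$ is the $x$-coordinate of $2^i Q$ given by the doubling formula $2(x,y) = \left(\frac{x^4+2mx^2+m^2}{4(x^3-mx)}, \ast\right)$ on $y^2 = x^3 - mx$, and for $i \geq 1$, $S_i$ is the denominator of the $x$-coordinate of $2^i Q$. Under the conditions $\gcd(S_i,p)=1$ for $1 \le i \le k-1$, the values $x_1, \ldots, x_{k-1}$ and hence $S_k$ are well defined modulo $p$. *)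

theory Defs
  imports Complex_Main "HOL-Number_Theory.Number_Theory"
begin

text \<open>
  Residue classes modulo \<open>p\<close> are represented by their least non-negative representatives.
  The curve is considered over \<open>\<int>/p\<int>\<close> for a modulus \<open>p\<close> that need not be prime,
  and only its affine points are collected.
\<close>

definition curve_points :: "int \<Rightarrow> int \<Rightarrow> (int \<times> int) set" where
  "curve_points p m =
     {(x, y). x \<in> {0..<p} \<and> y \<in> {0..<p} \<and> [y ^ 2 = x ^ 3 - m * x] (mod p)}"

definition dbl_denom :: "int \<Rightarrow> int \<Rightarrow> int" where
  "dbl_denom m x = 4 * (x ^ 3 - m * x)"

text \<open>
  \<open>x_seq p m x i\<close> is \<open>x\<^sub>i\<close>. It is defined in the informal sense only as long as
  \<open>S\<^sub>1, \<dots>, S\<^sub>i\<close> are invertible modulo \<open>p\<close>: on non-invertible arguments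
  \<^const>\<open>modular_inverse\<close> is \<open>0\<close>, so the values after that point carry no meaning.
\<close>

primrec x_seq :: "int \<Rightarrow> int \<Rightarrow> int \<Rightarrow> nat \<Rightarrow> int" where
  "x_seq p m x 0 = x"
| "x_seq p m x (Suc i) =
     (x_seq p m x i ^ 4 + 2 * m * x_seq p m x i ^ 2 + m ^ 2)
       * modular_inverse p (dbl_denom m (x_seq p m x i)) mod p"

primrec S_seq :: "int \<Rightarrow> int \<Rightarrow> int \<Rightarrow> nat \<Rightarrow> int" where
  "S_seq p m x 0 = x"
| "S_seq p m x (Suc i) = dbl_denom m (x_seq p m x i)"

end

theory Submission
  imports Defs "HOL-Algebra.Sylow"
begin

text \<open>
  Let \<open>s \<equiv> 3 (mod 4)\<close> be prime. The lemniscate \<open>(1 + u\<^sup>2) (1 + v\<^sup>2) = 2\<close> over \<open>\<int>/s\<int>\<close> is an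
  Edwards curve with non-square parameter \<open>- 1\<close>, so its addition law has no exceptional cases and
  makes it an abelian group; it has \<open>s + 1\<close> elements and a single element of order two. If \<open>m\<close> is a
  non-residue, a Moebius map sends \<open>x\<close>-coordinates on \<open>y\<^sup>2 = x\<^sup>3 - m x\<close> to second coordinates on the
  lemniscate and doubling to doubling, so \<open>S\<^sub>k \<equiv> 0\<close> with invertible \<open>S\<^sub>1, \<dots>, S\<^sub>k\<^sub>-\<^sub>1\<close> means
  order exactly \<open>2\<^sup>k\<close>. When \<open>p\<close> is prime, such a point exists because the Sylow 2-subgroup is cyclic.

  Conversely, \<open>p \<equiv> 3 (mod 4)\<close> has a prime factor \<open>s \<equiv> 3 (mod 4)\<close>, and reducing the given point
  modulo \<open>s\<close> yields \<open>2\<^sup>k dvd s + 1\<close> (through a 2-isogeny if \<open>m\<close> is a residue modulo \<open>s\<close>).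
  Then \<open>p / s \<equiv> 1 (mod 2\<^sup>k)\<close>, so \<open>p \<noteq> s\<close> would give \<open>p \<ge> (2\<^sup>k - 1) (2\<^sup>k + 1)\<close>,
  which contradicts \<open>n < 2\<^sup>k\<close>. This replaces the Hasse bound.
\<close>

section \<open>Elements of 2-power order in finite abelian groups\<close>

text \<open>Squaring is an endomorphism, so each non-empty fibre is a coset of its kernel and has at
  most two elements. The \<open>2 ^ Suc j\<close>-torsion lies over the \<open>2 ^ j\<close>-torsion
  under squaring, so the bound at most doubles.\<close>

lemma (in comm_group) card_pow_2_torsion_le:
  assumes fin: "finite (carrier G)" and K: "card {x \<in> carrier G. x \<otimes> x = \<one>} \<le> 2"
  shows "card {x \<in> carrier G. x [^] (2 ^ j :: nat) = \<one>} \<le> 2 ^ j"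
proof (induction j)
  case 0
  have "{x \<in> carrier G. x [^] (2 ^ 0 :: nat) = \<one>} = {\<one>}" by auto
  then show ?case by simp
next
  case (Suc j)
  let ?T = "\<lambda>j::nat. {x \<in> carrier G. x [^] (2 ^ j :: nat) = \<one>}"
  let ?F = "\<lambda>y. {x \<in> carrier G. x \<otimes> x = y}"
  have fibre: "card (?F y) \<le> 2" for y
  proof (cases "?F y = {}")
    case False
    then obtain a where a: "a \<in> carrier G" "a \<otimes> a = y" by blast
    have "?F y \<subseteq> (\<lambda>x. a \<otimes> x) ` {x \<in> carrier G. x \<otimes> x = \<one>}"
    proof
      fix x assume "x \<in> ?F y"
      then have x: "x \<in> carrier G" "x \<otimes> x = a \<otimes> a" using a by auto
      have "(inv a \<otimes> x) \<otimes> (inv a \<otimes> x) = (inv a \<otimes> inv a) \<otimes> (x \<otimes> x)"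
        using x(1) a(1) by (simp add: m_ac)
      also have "\<dots> = \<one>" using x(2) a(1) by (simp add: inv_mult[symmetric])
      finally have "inv a \<otimes> x \<in> {x \<in> carrier G. x \<otimes> x = \<one>}" using x a by simp
      moreover have "x = a \<otimes> (inv a \<otimes> x)" using x a by (simp add: m_assoc[symmetric])
      ultimately show "x \<in> (\<lambda>x. a \<otimes> x) ` {x \<in> carrier G. x \<otimes> x = \<one>}" by blast
    qed
    then have "card (?F y) \<le> card {x \<in> carrier G. x \<otimes> x = \<one>}"
      using fin by (intro surj_card_le) auto
    with K show ?thesis by simp
  qed (metis card.empty le0)
  have "?T (Suc j) \<subseteq> (\<Union>y\<in>?T j. ?F y)"
  proof
    fix x assume x: "x \<in> ?T (Suc j)"
    then have "(x \<otimes> x) [^] (2 ^ j :: nat) = \<one>"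
      using nat_pow_pow[of x 2 "2 ^ j"] by (simp add: numeral_2_eq_2)
    with x show "x \<in> (\<Union>y\<in>?T j. ?F y)" by auto
  qed
  then have "card (?T (Suc j)) \<le> card (\<Union>y\<in>?T j. ?F y)"
    using fin by (intro card_mono) auto
  also have "\<dots> \<le> (\<Sum>y\<in>?T j. card (?F y))"
    using fin by (intro card_UN_le) auto
  also have "\<dots> \<le> (\<Sum>y\<in>?T j. 2)" by (intro sum_mono fibre)
  also have "\<dots> \<le> 2 ^ Suc j" using Suc by simp
  finally show ?case .
qed

text \<open>A subgroup with exactly \<open>2 ^ Suc j\<close> elements does not fit into the
  \<open>2 ^ j\<close>-torsion; any of its elements outside that torsion is a witness, by
  Lagrange.\<close>

lemma (in comm_group) exists_order_2_power:
  assumes fin: "finite (carrier G)" and K: "card {x \<in> carrier G. x \<otimes> x = \<one>} \<le> 2"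
    and dvd: "2 ^ Suc j dvd order G"
  obtains x where "x \<in> carrier G" "x [^] (2 ^ Suc j :: nat) = \<one>" "x [^] (2 ^ j :: nat) \<noteq> \<one>"
proof -
  obtain m where "order G = 2 ^ Suc j * m" using dvd by blast
  then obtain H where H: "subgroup H G" "card H = 2 ^ Suc j"
    using sylow_thm[of 2 G "Suc j" m] fin is_group by auto
  interpret H: group "G\<lparr>carrier := H\<rparr>" using H(1) subgroup_imp_group by blast
  have sub: "H \<subseteq> carrier G" using H(1) subgroup.subset by blast
  have "\<not> H \<subseteq> {x \<in> carrier G. x [^] (2 ^ j :: nat) = \<one>}"
  proof
    assume "H \<subseteq> {x \<in> carrier G. x [^] (2 ^ j :: nat) = \<one>}"
    then have "card H \<le> card {x \<in> carrier G. x [^] (2 ^ j :: nat) = \<one>}"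
      using fin by (intro card_mono) auto
    also have "\<dots> \<le> 2 ^ j" by (rule card_pow_2_torsion_le[OF fin K])
    finally show False using H(2) by simp
  qed
  then obtain x where x: "x \<in> H" "x [^] (2 ^ j :: nat) \<noteq> \<one>" using sub by blast
  have "x [^] (2 ^ Suc j :: nat) = \<one>"
    using H.pow_order_eq_1[of x] x H(2) nat_pow_consistent[of x "2 ^ Suc j" H]
    by (simp add: order_def)
  then show ?thesis using that x sub by blast
qed

section \<open>The doubling sequence\<close>

lemma dbl_denom_eq: "dbl_denom m x = x * (4 * (x^2 - m))"
  by (simp add: dbl_denom_def algebra_simps power2_eq_square power3_eq_cube)

text \<open>The cross-multiplied form contains no modular inverse and hence passes to every divisor
  of \<open>p\<close>; this carries the sequence over to a prime factor.\<close>

lemma x_seq_double: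
  assumes "coprime (dbl_denom m (x_seq p m x i)) p"
  shows "[x_seq p m x (Suc i) * dbl_denom m (x_seq p m x i) =
    x_seq p m x i ^ 4 + 2 * m * x_seq p m x i ^ 2 + m ^ 2] (mod p)"
proof -
  let ?d = "dbl_denom m (x_seq p m x i)"
    and ?b = "x_seq p m x i ^ 4 + 2 * m * x_seq p m x i ^ 2 + m ^ 2"
  have "[?b * modular_inverse p ?d mod p * ?d = ?b * (modular_inverse p ?d * ?d)] (mod p)"
    by (simp add: cong_def mod_mult_left_eq mult.assoc)
  also have "[?b * (modular_inverse p ?d * ?d) = ?b * 1] (mod p)"
    using assms by (intro cong_mult cong_refl cong_modular_inverse2)
  finally show ?thesis by simp
qed

section \<open>The lemniscate\<close>

text \<open>Expansion of \<open>(1 + u^2) * (1 + v^2) = 2\<close>, which is the Edwards curve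
  \<open>u^2 + v^2 = 1 + d * u^2 * v^2\<close> with \<open>d = - 1\<close>.\<close>

definition on_lemniscate :: "int \<Rightarrow> int \<Rightarrow> int \<Rightarrow> bool" where
  "on_lemniscate s u v \<longleftrightarrow> s dvd u^2 * v^2 + u^2 + v^2 - 1"

text \<open>The Edwards addition law with neutral element \<open>(0, 1)\<close>, cross-multiplied so
  that arbitrary integers may represent the residues and no inverse occurs.\<close>

definition lemniscate_sum ::
    "int \<Rightarrow> int \<Rightarrow> int \<Rightarrow> int \<Rightarrow> int \<Rightarrow> int \<Rightarrow> int \<Rightarrow> bool" where
  "lemniscate_sum s x1 y1 x2 y2 x y \<longleftrightarrow>
     [x * (1 - x1 * x2 * y1 * y2) = x1 * y2 + y1 * x2] (mod s) \<and>
     [y * (1 + x1 * x2 * y1 * y2) = y1 * y2 - x1 * x2] (mod s)"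

definition lemniscate_add :: "int \<Rightarrow> int \<times> int \<Rightarrow> int \<times> int \<Rightarrow> int \<times> int" where
  "lemniscate_add s = (\<lambda>(x1, y1) (x2, y2).
     ((x1 * y2 + y1 * x2) * modular_inverse s (1 - x1 * x2 * y1 * y2) mod s,
      (y1 * y2 - x1 * x2) * modular_inverse s (1 + x1 * x2 * y1 * y2) mod s))"

definition lemniscate_group :: "int \<Rightarrow> (int \<times> int) monoid" where
  "lemniscate_group s =
     \<lparr>carrier = {(x, y). x \<in> {0..<s} \<and> y \<in> {0..<s} \<and> on_lemniscate s x y},
      monoid.mult = lemniscate_add s, one = (0, 1)\<rparr>"

text \<open>
  Associativity of the lemniscate addition law, cross-multiplied; the cofactors of the three curve
  equations come from polynomial division.
\<close>

lemma assoc_identity: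
  fixes x1 y1 x2 y2 x3 y3 :: int
  shows
   "((x1 * y2 + y1 * x2) * (1 + x1 * x2 * y1 * y2) * y3
       + (y1 * y2 - x1 * x2) * (1 - x1 * x2 * y1 * y2) * x3) *
    (x3^2 + y3^2 + x2^2 + y2^2 - (x3^2 + y3^2) * (x2^2 + y2^2)
       - (x3 * y2 + y3 * x2) * (y3 * y2 - x3 * x2) * x1 * y1) -
    ((x3 * y2 + y3 * x2) * (1 + x3 * x2 * y3 * y2) * y1
       + (y3 * y2 - x3 * x2) * (1 - x3 * x2 * y3 * y2) * x1) *
    (x1^2 + y1^2 + x2^2 + y2^2 - (x1^2 + y1^2) * (x2^2 + y2^2)
       - (x1 * y2 + y1 * x2) * (y1 * y2 - x1 * x2) * x3 * y3) =
    (x1^2 * y1^2 + x1^2 + y1^2 - 1) * (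
        x1 * x2^4 * y2 * x3^2 * y3 + x1 * x2^3 * y2^2 * x3^3 + y1 * x2^4 * y2 * x3 * y3^2 + y1
        * x2 * y2^4 * x3^2 * y3 - (x1 * x2^2 * y2^3 * y3^3 + x1 * x2 * y2^4 * x3 * y3^2 + y1 *
        x2^3 * y2^2 * y3^3 + y1 * x2^2 * y2^3 * x3^3)) +
    (x2^2 * y2^2 + x2^2 + y2^2 - 1) * (
        x1^3 * y2 * x3^2 * y3^3 + x1^3 * y2 * x3^2 * y3 + x1^3 * y2 * y3^3 + x1^2 * y1 * x2 *
        y3 + x1^2 * y1 * y2 * x3 + x1 * y1^2 * y2 * y3 + x1 * x2 * x3^3 + x1 * x2 * x3 * y3^2 +
        y1^3 * x2 * x3^2 * y3^3 + y1^3 * x2 * x3^2 * y3 + y1^3 * x2 * y3^3 + y1^3 * y2 * x3^3 *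
        y3^2 + y1^3 * y2 * x3^3 + y1^3 * y2 * x3 * y3^2 - (x1^3 * x2 * x3^3 * y3^2 + x1^3 * x2
        * x3^3 + x1^3 * x2 * x3 * y3^2 + x1 * y1^2 * x2 * x3 + x1 * y2 * x3^2 * y3 + x1 * y2 *
        y3^3 + y1 * x2 * x3^2 * y3 + y1 * x2 * y3^3 + y1 * y2 * x3^3 + y1 * y2 * x3 * y3^2)) +
    (x3^2 * y3^2 + x3^2 + y3^2 - 1) * (
        x1^3 * x2^3 * x3 + x1^3 * x2 * y2^2 * x3 + x1^3 * y2 * y3 + x1 * y1^2 * x2 * y2^4 * x3
        + y1^3 * x2 * y3 + y1^3 * y2 * x3 - (x1^3 * x2^2 * y2 * y3 + x1^3 * x2 * x3 + x1^3 *
        y2^3 * y3 + x1^2 * y1 * x2^4 * y2 * x3 + x1^2 * y1 * x2 * y2^4 * y3 + x1 * y1^2 * x2^4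
        * y2 * y3 + y1^3 * x2^3 * y3 + y1^3 * x2^2 * y2 * x3 + y1^3 * x2 * y2^2 * y3 + y1^3 *
        y2^3 * x3))"
  by (simp add: algebra_simps power2_eq_square power3_eq_cube power4_eq_xxxx)

section \<open>Squares modulo a prime congruent to 3 modulo 4\<close>

locale prime_3_mod_4 =
  fixes s :: int
  assumes prime_s: "prime s" and mod4: "s mod 4 = 3"
begin

lemma s_ge_3: "s \<ge> 3"
proof (rule ccontr)
  assume "\<not> s \<ge> 3"
  then have "s = 2" using prime_ge_2_int[OF prime_s] by simp
  with mod4 show False by simp
qed

lemma s_pos [simp]: "s > 0" "s \<noteq> 0"
  using s_ge_3 by auto

lemma not_dvd_2: "\<not> s dvd 2"
  using s_ge_3 zdvd_imp_le[of s 2] by auto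

lemma not_dvd_1: "\<not> s dvd 1"
  using s_ge_3 zdvd_imp_le[of s 1] by auto

lemma coprime_iff: "coprime a s \<longleftrightarrow> \<not> s dvd a"
  using prime_imp_coprime[OF prime_s, of a] coprime_absorb_left[of s a] prime_s not_prime_unit
  by (auto simp: coprime_commute)

lemma dvd_mult_iff: "s dvd a * b \<longleftrightarrow> s dvd a \<or> s dvd b"
  using prime_s by (simp add: prime_dvd_mult_iff)

lemma dvd_power2_iff: "s dvd a^2 \<longleftrightarrow> s dvd a"
  by (simp add: power2_eq_square dvd_mult_iff)

lemma cong_cancel: "\<not> s dvd c \<Longrightarrow> [a * c = b * c] (mod s) \<Longrightarrow> [a = b] (mod s)"
  by (simp add: cong_mult_rcancel coprime_iff)

lemma cong_inverse:
  assumes "\<not> s dvd a"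
  shows "[b * modular_inverse s a * a = b] (mod s)"
proof -
  have "[b * (modular_inverse s a * a) = b * 1] (mod s)"
    using assms by (intro cong_mult cong_refl cong_modular_inverse2) (simp add: coprime_iff)
  then show ?thesis by (simp add: mult.assoc)
qed

text \<open>Fermat's exponent \<open>s - 1\<close> is exhibited as twice an odd number; the odd half
  is what makes \<open>- 1\<close> a non-square.\<close>

lemma fermat:
  obtains t where "\<And>a. \<not> s dvd a \<Longrightarrow> [a ^ (2 * (2 * t + 1)) = 1] (mod s)"
proof
  define r where "r = nat s"
  define t where "t = nat (s div 4)"
  have "s div 4 \<ge> 0" using s_ge_3 by (simp add: pos_imp_zdiv_nonneg_iff)
  then have st: "s = 4 * int t + 3" using mod4 mult_div_mod_eq[of 4 s] by (simp add: t_def)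
  have r: "s = int r" "prime r" using prime_s prime_int_nat_transfer[of s] s_ge_3 unfolding r_def by linarith+
  have "r = 4 * t + 3" using st r(1) by linarith
  then have rt: "r - 1 = 2 * (2 * t + 1)" by simp
  fix a assume a: "\<not> s dvd a"
  have "\<not> r dvd nat (a mod s)"
    using a r by (metis dvd_mod_iff dvd_refl int_dvd_int_iff nat_0_le pos_mod_sign s_pos(1))
  then have "[nat (a mod s) ^ (r - 1) = 1] (mod r)" by (rule fermat_theorem[OF r(2)])
  then have "[(a mod s) ^ (r - 1) = 1] (mod s)"
    using r(1) by (metis cong_int_iff int_nat_eq of_nat_1 of_nat_power pos_mod_sign s_pos(1))
  then show "[a ^ (2 * (2 * t + 1)) = 1] (mod s)"
    unfolding rt by (simp only: cong_def power_mod)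
qed

text \<open>Otherwise \<open>a\<close> and \<open>b\<close> are both units, and raising
  \<open>a^2 = - (b^2)\<close> to the odd power \<open>2 * t + 1\<close> gives
  \<open>1 = - 1\<close> by Fermat. This is the form in which \<open>- 1\<close> being a non-square
  is used later.\<close>

lemma sum_squares_dvd:
  assumes "s dvd a^2 + b^2"
  shows "s dvd a" "s dvd b"
proof -
  have *: "s dvd a" if ab: "s dvd a^2 + b^2" for a b
  proof (rule ccontr)
    assume a: "\<not> s dvd a"
    then have b: "\<not> s dvd b"
      using ab by (metis dvd_add_left_iff dvd_power2_iff)
    obtain t where t: "\<And>a. \<not> s dvd a \<Longrightarrow> [a ^ (2 * (2 * t + 1)) = 1] (mod s)"
      using fermat by blast
    have "[a^2 = - (b^2)] (mod s)" using ab by (simp add: cong_iff_dvd_diff)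
    then have "[(a^2) ^ (2 * t + 1) = (- (b^2)) ^ (2 * t + 1)] (mod s)" by (rule cong_pow)
    then have "[a ^ (2 * (2 * t + 1)) = - (b ^ (2 * (2 * t + 1)))] (mod s)"
      unfolding power_mult by simp
    then have "[1 = - (1::int)] (mod s)"
      using t[OF a] t[OF b] by (meson cong_minus_minus_iff cong_sym cong_trans)
    then show False using not_dvd_2 by (simp add: cong_iff_dvd_diff)
  qed
  show "s dvd a" "s dvd b" using *[of a b] *[of b a] assms by (auto simp: add.commute)
qed

text \<open>By Fermat \<open>h = a ^ (2 * t + 1)\<close> squares to \<open>1\<close>, hence is
  \<open>1\<close> or \<open>- 1\<close>, and \<open>a ^ (t + 1)\<close> is a square root of
  \<open>h * a\<close>.\<close>

lemma square_or_minus_square: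
  obtains w where "[w^2 = a] (mod s) \<or> [w^2 = - a] (mod s)"
proof (cases "s dvd a")
  case True
  then show ?thesis using that[of 0] by (auto simp: cong_iff_dvd_diff)
next
  case False
  obtain t where t: "\<And>a. \<not> s dvd a \<Longrightarrow> [a ^ (2 * (2 * t + 1)) = 1] (mod s)"
    using fermat by blast
  define h where "h = a ^ (2 * t + 1)"
  have "s dvd h^2 - 1"
    using t[OF False] unfolding h_def cong_iff_dvd_diff power_mult[symmetric] mult.commute[of _ 2] .
  moreover have "h^2 - 1 = (h - 1) * (h + 1)" by (simp add: power2_eq_square algebra_simps)
  ultimately have "s dvd h - 1 \<or> s dvd h + 1" by (simp add: dvd_mult_iff)
  then have "[h = 1] (mod s) \<or> [h = -1] (mod s)" by (simp add: cong_iff_dvd_diff)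
  then have "[h * a = a] (mod s) \<or> [h * a = - a] (mod s)"
    by (metis cong_scalar_right mult_1 mult_minus1)
  moreover have "(a ^ (t + 1))^2 = h * a"
    by (simp add: h_def power_mult_distrib flip: power_mult)
       (simp add: power2_eq_square mult.commute)
  ultimately show ?thesis using that by metis
qed

section \<open>The group law on the lemniscate\<close>

text \<open>The addition law is complete: its denominators vanish only if \<open>-1\<close> is a square.\<close>

lemma denominators_nonzero:
  assumes "on_lemniscate s x1 y1" "on_lemniscate s x2 y2"
  shows "\<not> s dvd 1 - x1 * x2 * y1 * y2" "\<not> s dvd 1 + x1 * x2 * y1 * y2"
proof -
  have *: False if 1: "s dvd x1^2 * y1^2 + x1^2 + y1^2 - 1" 
    and 2: "s dvd x2^2 * y2^2 + x2^2 + y2^2 - 1" and d: "s dvd 1 - x1 * x2 * y1 * y2" for x1 y1 x2 y2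
  proof -
    have xy: "\<not> s dvd x1 * y1"
    proof
      assume "s dvd x1 * y1"
      then have "s dvd (x1 * y1) * (x2 * y2)" by simp
      then have "s dvd x1 * x2 * y1 * y2" by (simp add: mult_ac)
      with d have "s dvd (1 - x1 * x2 * y1 * y2) + x1 * x2 * y1 * y2" by (rule dvd_add)
      then show False using not_dvd_1 by simp
    qed
    \<comment> \<open>If \<open>x1 * x2 * y1 * y2 = 1\<close>, the curve equations make this sum of
      two squares vanish, so \<open>x2 + y2 = 0\<close>. The companion identity, with
      \<open>y1\<close> and \<open>y2\<close> negated, gives \<open>x2 - y2 = 0\<close>; then
      \<open>x2 = 0\<close> contradicts the product being \<open>1\<close>.\<close>
    have "(x1 - y1)^2 + (x1 * y1)^2 * (x2 + y2)^2 =
        (x1^2 * y1^2 + x1^2 + y1^2 - 1) + (x1 * y1)^2 * (x2^2 * y2^2 + x2^2 + y2^2 - 1)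
        + (1 - x1 * x2 * y1 * y2) * (1 + x1 * x2 * y1 * y2 - 2 * x1 * y1)"
      by (simp add: algebra_simps power2_eq_square)
    then have "s dvd (x1 - y1)^2 + (x1 * y1 * (x2 + y2))^2"
      using 1 2 d by (simp add: power_mult_distrib)
    then have p: "s dvd x2 + y2" using sum_squares_dvd(2) xy dvd_mult_iff by blast
    have "(x1 + y1)^2 + (x1 * y1)^2 * (x2 - y2)^2 =
        (x1^2 * y1^2 + x1^2 + y1^2 - 1) + (x1 * y1)^2 * (x2^2 * y2^2 + x2^2 + y2^2 - 1)
        + (1 - x1 * x2 * y1 * y2) * (1 + x1 * x2 * y1 * y2 + 2 * x1 * y1)"
      by (simp add: algebra_simps power2_eq_square)
    then have "s dvd (x1 + y1)^2 + (x1 * y1 * (x2 - y2))^2"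
      using 1 2 d by (simp add: power_mult_distrib)
    then have m: "s dvd x2 - y2" using sum_squares_dvd(2) xy dvd_mult_iff by blast
    have "s dvd 2 * x2" using dvd_add[OF p m] by simp
    then have "s dvd x2" using dvd_mult_iff not_dvd_2 by blast
    then have "s dvd x1 * x2 * y1 * y2" by simp
    with d have "s dvd (1 - x1 * x2 * y1 * y2) + x1 * x2 * y1 * y2" by (rule dvd_add)
    then show False using not_dvd_1 by simp
  qed
  show "\<not> s dvd 1 - x1 * x2 * y1 * y2"
    using *[of x1 y1 x2 y2] assms unfolding on_lemniscate_def by blast
  \<comment> \<open>Negating \<open>x1\<close> preserves the curve and exchanges the two
    denominators.\<close>
  show "\<not> s dvd 1 + x1 * x2 * y1 * y2"
    using *[of "- x1" y1 x2 y2] assms unfolding on_lemniscate_def by auto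
qed

text \<open>Multiplied by \<open>(1 - d)^2 * (1 + d)^2\<close>, the curve equation of the sum
  becomes a polynomial in the summands, which is an explicit combination of their two curve
  equations. The factor is a unit and cancels.\<close>

lemma on_lemniscate_sum:
  assumes c1: "on_lemniscate s x1 y1" and c2: "on_lemniscate s x2 y2"
    and sum: "lemniscate_sum s x1 y1 x2 y2 x y"
  shows "on_lemniscate s x y"
proof -
  define d where "d = x1 * x2 * y1 * y2"
  have x: "[x * (1 - d) = x1 * y2 + y1 * x2] (mod s)"
    and y: "[y * (1 + d) = y1 * y2 - x1 * x2] (mod s)"
    using sum by (simp_all add: lemniscate_sum_def d_def)
  have nz: "\<not> s dvd 1 - d" "\<not> s dvd 1 + d"
    using denominators_nonzero[OF c1 c2] by (simp_all add: d_def)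
  have "[(x * (1 - d))^2 * (y * (1 + d))^2 + (1 + d)^2 * (x * (1 - d))^2
        + (1 - d)^2 * (y * (1 + d))^2 - (1 - d)^2 * (1 + d)^2 =
      (x1 * y2 + y1 * x2)^2 * (y1 * y2 - x1 * x2)^2 + (1 + d)^2 * (x1 * y2 + y1 * x2)^2
        + (1 - d)^2 * (y1 * y2 - x1 * x2)^2 - (1 - d)^2 * (1 + d)^2] (mod s)"
    by (intro cong_add cong_diff cong_mult cong_pow x y cong_refl)
  moreover have "(x1 * y2 + y1 * x2)^2 * (y1 * y2 - x1 * x2)^2 + (1 + d)^2 * (x1 * y2 + y1 * x2)^2
        + (1 - d)^2 * (y1 * y2 - x1 * x2)^2 - (1 - d)^2 * (1 + d)^2 =
      (x1^2 * y1^2 + x1^2 + y1^2 - 1) * (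
        x1^2 * x2^4 * y2^4 + x1^2 * x2^4 * y2^2 + x1^2 * x2^2 * y2^4 + y1^2 * x2^4 * y2^4
        + y1^2 * x2^4 * y2^2 + y1^2 * x2^2 * y2^4 + x2^4 + 6 * x2^2 * y2^2 + y2^4 - (x1^2
        * y1^2 * x2^4 * y2^4 + 3 * x2^4 * y2^4 + 2 * x2^4 * y2^2 + 2 * x2^2 * y2^4)) +
      (x2^2 * y2^2 + x2^2 + y2^2 - 1) * (
        4 * x1^2 * x2^2 * y2^2 + 4 * y1^2 * x2^2 * y2^2 + x2^2 + y2^2 + 1 - (x1^4 * x2^2 *
        y2^2 + x1^2 * x2^2 + x1^2 * y2^2 + y1^4 * x2^2 * y2^2 + y1^2 * x2^2 + y1^2 * y2^2
        + 3 * x2^2 * y2^2))"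
    unfolding d_def by (simp add: algebra_simps power2_eq_square power4_eq_xxxx)
  moreover have "s dvd \<dots>"
    using c1 c2 unfolding on_lemniscate_def by (intro dvd_add dvd_mult2)
  ultimately have "s dvd (x * (1 - d))^2 * (y * (1 + d))^2 + (1 + d)^2 * (x * (1 - d))^2
        + (1 - d)^2 * (y * (1 + d))^2 - (1 - d)^2 * (1 + d)^2"
    by (simp add: cong_dvd_iff)
  also have "(x * (1 - d))^2 * (y * (1 + d))^2 + (1 + d)^2 * (x * (1 - d))^2
        + (1 - d)^2 * (y * (1 + d))^2 - (1 - d)^2 * (1 + d)^2 =
      (1 - d)^2 * (1 + d)^2 * (x^2 * y^2 + x^2 + y^2 - 1)"
    by (simp add: algebra_simps power2_eq_square)
  finally show ?thesis
    using nz unfolding on_lemniscate_def dvd_mult_iff dvd_power2_iff by blast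
qed

lemma lemniscate_sum_unique:
  assumes "on_lemniscate s x1 y1" "on_lemniscate s x2 y2"
    and "lemniscate_sum s x1 y1 x2 y2 x y" "lemniscate_sum s x1 y1 x2 y2 x' y'"
  shows "[x = x'] (mod s)" "[y = y'] (mod s)"
  using assms(3,4) denominators_nonzero[OF assms(1,2)] unfolding lemniscate_sum_def
  by (meson cong_cancel cong_sym cong_trans)+

section \<open>Associativity of the addition law\<close>

text \<open>Each bracketing is written as a fraction \<open>N / M\<close> in the six original
  coordinates with a unit \<open>M\<close>; \<open>assoc_identity\<close> says that the two
  fractions agree.\<close>

lemma lemniscate_sum_assoc_fst:
  assumes c1: "on_lemniscate s x1 y1" and c2: "on_lemniscate s x2 y2" and c3: "on_lemniscate s x3 y3"
    and s12: "lemniscate_sum s x1 y1 x2 y2 x12 y12"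
    and s23: "lemniscate_sum s x2 y2 x3 y3 x23 y23"
    and x: "[x * (1 - x12 * x3 * y12 * y3) = x12 * y3 + y12 * x3] (mod s)"
    and x': "[x' * (1 - x1 * x23 * y1 * y23) = x1 * y23 + y1 * x23] (mod s)"
  shows "[x = x'] (mod s)"
proof -
  define N where "N x1 y1 x2 y2 x3 y3 = (x1 * y2 + y1 * x2) * (1 + x1 * x2 * y1 * y2) * y3
       + (y1 * y2 - x1 * x2) * (1 - x1 * x2 * y1 * y2) * x3" for x1 y1 x2 y2 x3 y3 :: int
  \<comment> \<open>The natural denominator starts with \<open>(1 - d) * (1 + d)\<close>; the curve
    equations for the first two points replace this by an expression of lower degree.\<close>
  define M where "M x1 y1 x2 y2 x3 y3 = (x1^2 + y1^2 + x2^2 + y2^2 - (x1^2 + y1^2) * (x2^2 + y2^2)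
       - (x1 * y2 + y1 * x2) * (y1 * y2 - x1 * x2) * x3 * y3)" for x1 y1 x2 y2 x3 y3 :: int
  have fraction: "[z * M x1 y1 x2 y2 x3 y3 = N x1 y1 x2 y2 x3 y3] (mod s)
      \<and> \<not> s dvd M x1 y1 x2 y2 x3 y3"
    if c1: "on_lemniscate s x1 y1" and c2: "on_lemniscate s x2 y2" and c3: "on_lemniscate s x3 y3"
      and s12: "lemniscate_sum s x1 y1 x2 y2 x12 y12"
      and z: "[z * (1 - x12 * x3 * y12 * y3) = x12 * y3 + y12 * x3] (mod s)"
    for x1 y1 x2 y2 x3 y3 x12 y12 z
  proof -
    define d where "d = x1 * x2 * y1 * y2"
    have x12: "[x12 * (1 - d) = x1 * y2 + y1 * x2] (mod s)"
      and y12: "[y12 * (1 + d) = y1 * y2 - x1 * x2] (mod s)"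
      using s12 by (simp_all add: lemniscate_sum_def d_def)
    have nz: "\<not> s dvd 1 - d" "\<not> s dvd 1 + d" "\<not> s dvd 1 - x12 * x3 * y12 * y3"
      using denominators_nonzero[OF c1 c2] denominators_nonzero[OF on_lemniscate_sum[OF c1 c2 s12] c3]
      by (simp_all add: d_def)
    have "(1 - d) * (1 + d) - (x1 * y2 + y1 * x2) * (y1 * y2 - x1 * x2) * x3 * y3
          - M x1 y1 x2 y2 x3 y3 =
        (x1^2 * y1^2 + x1^2 + y1^2 - 1) * (x2^2 + y2^2 - 1)
        + (x2^2 * y2^2 + x2^2 + y2^2 - 1) * (- (x1^2 * y1^2))"
      unfolding M_def d_def by (simp add: algebra_simps power2_eq_square)
    also have "s dvd \<dots>"
      using c1 c2 unfolding on_lemniscate_def by (intro dvd_add dvd_mult2)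
    finally have M: "[(1 - d) * (1 + d) - (x1 * y2 + y1 * x2) * (y1 * y2 - x1 * x2) * x3 * y3 =
        M x1 y1 x2 y2 x3 y3] (mod s)"
      by (simp add: cong_iff_dvd_diff)
    have "(1 - d) * (1 + d) * (1 - x12 * x3 * y12 * y3) =
        (1 - d) * (1 + d) - (x12 * (1 - d)) * (y12 * (1 + d)) * x3 * y3"
      by (simp add: algebra_simps)
    also have "[\<dots> = (1 - d) * (1 + d) - (x1 * y2 + y1 * x2) * (y1 * y2 - x1 * x2) * x3 * y3] (mod s)"
      by (intro cong_add cong_diff cong_mult x12 y12 cong_refl)
    also note M
    finally have D: "[(1 - d) * (1 + d) * (1 - x12 * x3 * y12 * y3) = M x1 y1 x2 y2 x3 y3] (mod s)" .
    moreover have "\<not> s dvd (1 - d) * (1 + d) * (1 - x12 * x3 * y12 * y3)"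
      using nz by (simp add: dvd_mult_iff)
    ultimately have "\<not> s dvd M x1 y1 x2 y2 x3 y3"
      by (simp add: cong_dvd_iff)
    moreover have "[z * M x1 y1 x2 y2 x3 y3 = N x1 y1 x2 y2 x3 y3] (mod s)"
    proof -
      have "[z * M x1 y1 x2 y2 x3 y3 = z * ((1 - d) * (1 + d) * (1 - x12 * x3 * y12 * y3))] (mod s)"
        by (intro cong_mult cong_refl cong_sym[OF D])
      also have "z * ((1 - d) * (1 + d) * (1 - x12 * x3 * y12 * y3)) =
          (1 - d) * (1 + d) * (z * (1 - x12 * x3 * y12 * y3))"
        by (simp add: mult_ac)
      also have "[\<dots> = (1 - d) * (1 + d) * (x12 * y3 + y12 * x3)] (mod s)"
        by (intro cong_mult cong_refl z)
      also have "(1 - d) * (1 + d) * (x12 * y3 + y12 * x3) =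
          (x12 * (1 - d)) * (1 + d) * y3 + (y12 * (1 + d)) * (1 - d) * x3"
        by (simp add: algebra_simps)
      also have "[\<dots> = N x1 y1 x2 y2 x3 y3] (mod s)"
        unfolding N_def d_def[symmetric]
        by (intro cong_add cong_mult x12 y12 cong_refl)
      finally show ?thesis .
    qed
    ultimately show ?thesis by blast
  qed
  \<comment> \<open>By commutativity the second bracketing is \<open>(P3 + P2) + P1\<close>, so the
    same fraction applies with the outer points exchanged.\<close>
  have s32: "lemniscate_sum s x3 y3 x2 y2 x23 y23"
    using s23 by (simp add: lemniscate_sum_def algebra_simps)
  have x'': "[x' * (1 - x23 * x1 * y23 * y1) = x23 * y1 + y23 * x1] (mod s)"
    using x' by (simp add: algebra_simps)
  note left = fraction[OF c1 c2 c3 s12 x] and right = fraction[OF c3 c2 c1 s32 x'']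
  let ?M = "M x1 y1 x2 y2 x3 y3" and ?N = "N x1 y1 x2 y2 x3 y3"
    and ?M' = "M x3 y3 x2 y2 x1 y1" and ?N' = "N x3 y3 x2 y2 x1 y1"
  have "s dvd ?N * ?M' - ?N' * ?M"
    unfolding N_def M_def assoc_identity
    using c1 c2 c3 unfolding on_lemniscate_def by (intro dvd_add dvd_mult2)
  then have NM: "[?N * ?M' = ?N' * ?M] (mod s)" by (simp add: cong_iff_dvd_diff)
  have "[(x * ?M) * ?M' = ?N * ?M'] (mod s)"
    using left by (intro cong_mult cong_refl) blast
  also note NM
  also have "[?N' * ?M = (x' * ?M') * ?M] (mod s)"
    using right by (intro cong_mult cong_refl cong_sym[of "x' * ?M'"]) blast
  finally have "[x * (?M * ?M') = x' * (?M * ?M')] (mod s)" by (simp add: mult_ac)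
  then show ?thesis
    using cong_cancel[of "?M * ?M'"] left right dvd_mult_iff by blast
qed

text \<open>
  Adding the point \<open>(1, 0)\<close> of order \<open>4\<close> maps \<open>(x, y)\<close> to \<open>(y, - x)\<close>; this turns second
  coordinates of sums into first coordinates.
\<close>

lemma lemniscate_sum_assoc:
  assumes c1: "on_lemniscate s x1 y1" and c2: "on_lemniscate s x2 y2" and c3: "on_lemniscate s x3 y3"
    and s12: "lemniscate_sum s x1 y1 x2 y2 x12 y12"
    and s23: "lemniscate_sum s x2 y2 x3 y3 x23 y23"
    and s: "lemniscate_sum s x12 y12 x3 y3 x y"
    and s': "lemniscate_sum s x1 y1 x23 y23 x' y'"
  shows "[x = x'] (mod s)" "[y = y'] (mod s)"
proof -
  show "[x = x'] (mod s)"
    using lemniscate_sum_assoc_fst[OF c1 c2 c3 s12 s23] s s' unfolding lemniscate_sum_def by blast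
  have c1': "on_lemniscate s y1 (- x1)"
    using c1 by (simp add: on_lemniscate_def algebra_simps)
  have "[- (x12 * (1 - x1 * x2 * y1 * y2)) = - (x1 * y2 + y1 * x2)] (mod s)"
    using s12 cong_minus_minus_iff unfolding lemniscate_sum_def by blast
  then have s12': "lemniscate_sum s y1 (- x1) x2 y2 y12 (- x12)"
    using s12 by (simp add: lemniscate_sum_def algebra_simps)
  show "[y = y'] (mod s)"
    by (rule lemniscate_sum_assoc_fst[OF c1' c2 c3 s12' s23])
       (use s s' in \<open>simp_all add: lemniscate_sum_def algebra_simps\<close>)
qed

section \<open>The group of reduced points\<close>

abbreviation G :: "(int \<times> int) monoid" where
  "G \<equiv> lemniscate_group s"

lemma carrier_iff:
  "(x, y) \<in> carrier G \<longleftrightarrow> x \<in> {0..<s} \<and> y \<in> {0..<s} \<and> on_lemniscate s x y"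
  by (simp add: lemniscate_group_def)

lemma carrier_eqI:
  assumes "(x, y) \<in> carrier G" "(x', y') \<in> carrier G" "[x = x'] (mod s)" "[y = y'] (mod s)"
  shows "(x, y) = (x', y')"
  using assms cong_less_imp_eq_int[of x s x'] cong_less_imp_eq_int[of y s y']
  by (auto simp: carrier_iff)

lemma one_group: "\<one>\<^bsub>G\<^esub> = (0, 1)"
  by (simp add: lemniscate_group_def)

lemma add_sum:
  assumes "on_lemniscate s x1 y1" "on_lemniscate s x2 y2"
    and "(x1, y1) \<otimes>\<^bsub>G\<^esub> (x2, y2) = (x, y)"
  shows "lemniscate_sum s x1 y1 x2 y2 x y" "x \<in> {0..<s}" "y \<in> {0..<s}"
proof -
  have inv: "[b * modular_inverse s a mod s * a = b] (mod s)" if "\<not> s dvd a" for a b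
    using cong_inverse[OF that, of b] by (simp add: cong_def mod_mult_left_eq)
  show "lemniscate_sum s x1 y1 x2 y2 x y"
    using assms(3) denominators_nonzero[OF assms(1,2)] inv
    by (auto simp: lemniscate_group_def lemniscate_add_def lemniscate_sum_def)
  show "x \<in> {0..<s}" "y \<in> {0..<s}"
    using assms(3) by (auto simp: lemniscate_group_def lemniscate_add_def)
qed

lemma add_closed:
  assumes "P \<in> carrier G" "Q \<in> carrier G"
  shows "P \<otimes>\<^bsub>G\<^esub> Q \<in> carrier G"
proof -
  obtain x1 y1 x2 y2 x y where PQ: "P = (x1, y1)" "Q = (x2, y2)" "P \<otimes>\<^bsub>G\<^esub> Q = (x, y)"
    by (metis surj_pair)
  then show ?thesis
    using assms add_sum[of x1 y1 x2 y2 x y] on_lemniscate_sum[of x1 y1 x2 y2 x y]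
    by (simp add: carrier_iff)
qed

lemma comm_group_G: "comm_group G"
proof (rule comm_groupI)
  show "P \<otimes>\<^bsub>G\<^esub> Q \<in> carrier G" if "P \<in> carrier G" "Q \<in> carrier G" for P Q
    using that by (rule add_closed)
  show "\<one>\<^bsub>G\<^esub> \<in> carrier G"
    using s_ge_3 by (simp add: one_group carrier_iff on_lemniscate_def)
  show "P \<otimes>\<^bsub>G\<^esub> Q = Q \<otimes>\<^bsub>G\<^esub> P" for P Q
    by (auto simp: lemniscate_group_def lemniscate_add_def split: prod.splits)
       (simp_all add: algebra_simps)
  show "\<one>\<^bsub>G\<^esub> \<otimes>\<^bsub>G\<^esub> P = P" if "P \<in> carrier G" for P
    using that s_ge_3 by (auto simp: lemniscate_group_def lemniscate_add_def)
  show "P \<otimes>\<^bsub>G\<^esub> Q \<otimes>\<^bsub>G\<^esub> R = P \<otimes>\<^bsub>G\<^esub> (Q \<otimes>\<^bsub>G\<^esub> R)"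
    if PQR: "P \<in> carrier G" "Q \<in> carrier G" "R \<in> carrier G" for P Q R
  proof -
    obtain x1 y1 x2 y2 x3 y3 where eq: "P = (x1, y1)" "Q = (x2, y2)" "R = (x3, y3)"
      by (metis surj_pair)
    obtain x12 y12 x23 y23 x y x' y' where
      sums: "P \<otimes>\<^bsub>G\<^esub> Q = (x12, y12)" "Q \<otimes>\<^bsub>G\<^esub> R = (x23, y23)"
        "(x12, y12) \<otimes>\<^bsub>G\<^esub> R = (x, y)" "P \<otimes>\<^bsub>G\<^esub> (x23, y23) = (x', y')"
      by (metis surj_pair)
    have c: "(x12, y12) \<in> carrier G" "(x23, y23) \<in> carrier G"
        "(x, y) \<in> carrier G" "(x', y') \<in> carrier G"
      using PQR add_closed sums by metis+
    have on: "on_lemniscate s x1 y1" "on_lemniscate s x2 y2" "on_lemniscate s x3 y3"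
        "on_lemniscate s x12 y12" "on_lemniscate s x23 y23"
      using PQR c by (simp_all add: eq carrier_iff)
    have "[x = x'] (mod s)" "[y = y'] (mod s)"
      using lemniscate_sum_assoc[OF on(1-3) add_sum(1)[OF on(1,2)] add_sum(1)[OF on(2,3)]
          add_sum(1)[OF on(4,3)] add_sum(1)[OF on(1,5)]] sums
      unfolding eq by blast+
    then show ?thesis
      using carrier_eqI[OF c(3,4)] sums by simp
  qed
  show "\<exists>Q\<in>carrier G. Q \<otimes>\<^bsub>G\<^esub> P = \<one>\<^bsub>G\<^esub>" if P: "P \<in> carrier G" for P
  proof -
    obtain x y where xy: "P = (x, y)" by fastforce
    \<comment> \<open>The inverse of \<open>(x, y)\<close> is \<open>(- x, y)\<close>, as for sine
      and cosine.\<close>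
    have "on_lemniscate s (- x mod s) y"
    proof -
      have "[(- x mod s)^2 * y^2 + (- x mod s)^2 + y^2 - 1 = (- x)^2 * y^2 + (- x)^2 + y^2 - 1] (mod s)"
        by (intro cong_add cong_diff cong_mult cong_pow cong_refl) (simp_all add: cong_def)
      then show ?thesis
        using P by (simp add: xy carrier_iff on_lemniscate_def cong_dvd_iff)
    qed
    then have c: "(- x mod s, y) \<in> carrier G"
      using P by (simp add: xy carrier_iff)
    have on: "on_lemniscate s (- x mod s) y" "on_lemniscate s x y"
      using c P by (simp_all add: xy carrier_iff)
    obtain a b where ab: "(- x mod s, y) \<otimes>\<^bsub>G\<^esub> P = (a, b)" by fastforce
    then have sum: "lemniscate_sum s (- x mod s) y x y a b"
      using add_sum(1)[OF on] by (simp add: xy)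
    have neg: "[- x mod s = - x] (mod s)" by (simp add: cong_def)
    have "lemniscate_sum s (- x mod s) y x y 0 1"
      unfolding lemniscate_sum_def
    proof
      have "[(- x mod s) * y + y * x = (- x) * y + y * x] (mod s)"
        by (intro cong_add cong_mult neg cong_refl)
      then show "[0 * (1 - (- x mod s) * x * y * y) = (- x mod s) * y + y * x] (mod s)"
        by (simp add: cong_sym_eq mult.commute)
      have "[(1 + (- x mod s) * x * y * y) - (y * y - (- x mod s) * x) =
          (1 + (- x) * x * y * y) - (y * y - (- x) * x)] (mod s)"
        by (intro cong_add cong_diff cong_mult neg cong_refl)
      moreover have "(1 + (- x) * x * y * y) - (y * y - (- x) * x) = - (x^2 * y^2 + x^2 + y^2 - 1)"
        by (simp add: algebra_simps power2_eq_square)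
      moreover have "s dvd - (x^2 * y^2 + x^2 + y^2 - 1)"
        using on(2) unfolding on_lemniscate_def by (rule dvd_minus_iff[THEN iffD2])
      ultimately show "[1 * (1 + (- x mod s) * x * y * y) = y * y - (- x mod s) * x] (mod s)"
        by (metis cong_dvd_iff cong_iff_dvd_diff mult_1)
    qed
    then have "[a = 0] (mod s)" "[b = 1] (mod s)"
      using lemniscate_sum_unique[OF on sum] by blast+
    moreover have "(a, b) \<in> carrier G" using add_closed[OF c P] ab by simp
    moreover have "(0, 1) \<in> carrier G"
      using s_ge_3 by (simp add: carrier_iff on_lemniscate_def)
    ultimately have "(a, b) = (0, 1)" by (intro carrier_eqI)
    then show ?thesis using ab c one_group by metis
  qed
qed

section \<open>The group order\<close>

lemma card_square_roots:
  assumes w: "[w^2 = a] (mod s)" and a: "\<not> s dvd a"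
  shows "card {u \<in> {0..<s}. [u^2 = a] (mod s)} = 2"
    and "card {u \<in> {0..<s}. [u^2 = - a] (mod s)} = 0"
proof -
  have sw: "\<not> s dvd w" using w a by (metis cong_dvd_iff dvd_power2_iff)
  have sq: "[u^2 = a] (mod s) \<longleftrightarrow> [u = w] (mod s) \<or> [u = - w] (mod s)" for u
  proof -
    have "[u^2 = a] (mod s) \<longleftrightarrow> [u^2 = w^2] (mod s)"
      using w by (meson cong_sym cong_trans)
    also have "\<dots> \<longleftrightarrow> s dvd (u - w) * (u + w)"
      by (simp add: cong_iff_dvd_diff power2_eq_square algebra_simps)
    finally show ?thesis by (simp add: dvd_mult_iff cong_iff_dvd_diff)
  qed
  have "{u \<in> {0..<s}. [u^2 = a] (mod s)} = {w mod s, - w mod s}"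
    unfolding sq by (auto simp: cong_def)
  moreover have "w mod s \<noteq> - w mod s"
  proof
    assume "w mod s = - w mod s"
    then have "s dvd 2 * w" by (simp add: mod_eq_dvd_iff)
    then show False using sw not_dvd_2 dvd_mult_iff by blast
  qed
  ultimately show "card {u \<in> {0..<s}. [u^2 = a] (mod s)} = 2" by simp
  have "{u \<in> {0..<s}. [u^2 = - a] (mod s)} = {}"
  proof safe
    fix u assume "[u^2 = - a] (mod s)"
    then have "[u^2 + w^2 = - a + a] (mod s)" using w by (rule cong_add)
    then have "s dvd u^2 + w^2" by (simp add: cong_iff_dvd_diff)
    then show "u \<in> {}" using sw sum_squares_dvd(2) by blast
  qed
  then show "card {u \<in> {0..<s}. [u^2 = - a] (mod s)} = 0" by (simp only: card.empty)
qed

text \<open>For a unit \<open>a\<close>, exactly one of \<open>a\<close> and \<open>- a\<close> is a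
  square, and it has two roots; for \<open>a = 0\<close> both sets consist of the root zero
  alone.\<close>

lemma card_square_roots_add:
  "card {u \<in> {0..<s}. [u^2 = a] (mod s)} + card {u \<in> {0..<s}. [u^2 = - a] (mod s)} = 2"
proof (cases "s dvd a")
  case True
  have "{u \<in> {0..<s}. [u^2 = b] (mod s)} = {0}" if "s dvd b" for b
    using that zdvd_imp_le[of s]
    by (force simp: cong_iff_dvd_diff dvd_diff_right_iff dvd_diff_left_iff dvd_power2_iff)
  then show ?thesis using True by simp
next
  case False
  obtain w where "[w^2 = a] (mod s) \<or> [w^2 = - a] (mod s)"
    using square_or_minus_square by blast
  then show ?thesis
    using card_square_roots[of w a] card_square_roots[of w "- a"] False by auto
qed

lemma not_dvd_one_plus_square: "\<not> s dvd 1 + v^2"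
  using sum_squares_dvd(1)[of 1 v] not_dvd_1 by auto

lemma on_lemniscate_iff: "on_lemniscate s u v \<longleftrightarrow> [u^2 * (1 + v^2) = 1 - v^2] (mod s)"
proof -
  have "u^2 * (1 + v^2) - (1 - v^2) = u^2 * v^2 + u^2 + v^2 - 1" by (simp add: algebra_simps)
  then show ?thesis by (simp only: on_lemniscate_def cong_iff_dvd_diff)
qed

definition fibre :: "int \<Rightarrow> int set" where
  "fibre v = {u \<in> {0..<s}. on_lemniscate s u v}"

lemma fibre_eq:
  assumes "[a * (1 + v^2) = 1 - v^2] (mod s)"
  shows "fibre v = {u \<in> {0..<s}. [u^2 = a] (mod s)}"
proof -
  have "on_lemniscate s u v \<longleftrightarrow> [u^2 * (1 + v^2) = a * (1 + v^2)] (mod s)" for u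
    unfolding on_lemniscate_iff using assms by (meson cong_sym cong_trans)
  also have "\<dots> u \<longleftrightarrow> [u^2 = a] (mod s)" for u
    using not_dvd_one_plus_square[of v] by (simp add: cong_mult_rcancel coprime_iff)
  finally show ?thesis by (simp add: fibre_def)
qed

text \<open>On the curve, \<open>u\<^sup>2 = (1 - v\<^sup>2) / (1 + v\<^sup>2)\<close>, and \<open>v \<mapsto> 1 / v\<close> changes the sign of the right-hand side.\<close>

lemma card_fibre_inverse:
  assumes "[v * v' = 1] (mod s)"
  shows "card (fibre v) + card (fibre v') = 2"
proof -
  define a where "a = (1 - v^2) * modular_inverse s (1 + v^2)"
  have a: "[a * (1 + v^2) = 1 - v^2] (mod s)"
    unfolding a_def using not_dvd_one_plus_square by (rule cong_inverse)
  have v: "\<not> s dvd v"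
    using assms not_dvd_1 by (metis cong_dvd_iff dvd_mult2)
  have vv': "[v'^2 * v^2 = 1] (mod s)"
    using cong_pow[OF assms, of 2] by (simp add: power_mult_distrib mult.commute)
  have "[- a * (v^2 + v'^2 * v^2) = - a * (v^2 + 1)] (mod s)"
    by (intro cong_mult cong_add vv' cong_refl)
  also have "- a * (v^2 + 1) = - (a * (1 + v^2))" by (simp add: algebra_simps)
  also have "[- (a * (1 + v^2)) = - (1 - v^2)] (mod s)"
    using a cong_minus_minus_iff by blast
  also have "- (1 - v^2) = v^2 - 1" by simp
  also have "[v^2 - 1 = v^2 - v'^2 * v^2] (mod s)"
    by (intro cong_diff cong_refl cong_sym[OF vv'])
  finally have "[(- a * (1 + v'^2)) * v^2 = (1 - v'^2) * v^2] (mod s)"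
    by (simp add: algebra_simps)
  then have a': "[- a * (1 + v'^2) = 1 - v'^2] (mod s)"
    using cong_cancel v dvd_power2_iff by blast
  show ?thesis
    unfolding fibre_eq[OF a] fibre_eq[OF a'] by (rule card_square_roots_add)
qed

lemma finite_carrier: "finite (carrier G)"
proof (rule finite_subset)
  show "carrier G \<subseteq> {0..<s} \<times> {0..<s}" by (auto simp: carrier_iff)
qed simp

text \<open>Points are counted by their second coordinate \<open>v\<close>. The fibre over
  \<open>0\<close> has two points; over the other \<open>s - 1\<close> values the pairing of
  \<open>v\<close> with \<open>1 / v\<close> gives one point per fibre on average.\<close>

lemma order_G: "int (order G) = s + 1"
proof -
  have bij: "bij_betw (\<lambda>(v, u). (u, v)) (SIGMA v:{0..<s}. fibre v) (carrier G)"
    by (rule bij_betwI[where g = "\<lambda>(u, v). (v, u)"]) (auto simp: fibre_def carrier_iff)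
  have fin: "finite (fibre v)" for v
    by (rule finite_subset[of _ "{0..<s}"]) (auto simp: fibre_def)
  have "order G = (\<Sum>v\<in>{0..<s}. card (fibre v))"
    using bij_betw_same_card[OF bij] fin by (simp add: order_def)
  also have "{0..<s} = insert 0 {1..<s}" by auto
  finally have total: "order G = card (fibre 0) + (\<Sum>v\<in>{1..<s}. card (fibre v))" by simp
  have "fibre 0 = {u \<in> {0..<s}. [u^2 = 1] (mod s)}" by (rule fibre_eq) simp
  then have fibre_0: "card (fibre 0) = 2"
    using card_square_roots(1)[of 1 1] not_dvd_1 by simp
  let ?i = "modular_inverse s"
  have i: "?i v \<in> {1..<s}" "?i (?i v) = v" "[v * ?i v = 1] (mod s)" if "v \<in> {1..<s}" for v
  proof -
    have "\<not> s dvd v" using that zdvd_not_zless by auto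
    then have c: "coprime v s" by (simp add: coprime_iff)
    then show *: "[v * ?i v = 1] (mod s)" by (rule cong_modular_inverse1)
    show "?i v \<in> {1..<s}"
      using mult_modular_inverse_int_pos[of s v] modular_inverse_int_less[of s v] c s_ge_3 by simp
    show "?i (?i v) = v"
      using * that by (intro modular_inverse_int_eqI) (auto simp: mult.commute)
  qed
  have "(\<Sum>v\<in>{1..<s}. card (fibre v)) = (\<Sum>v\<in>{1..<s}. card (fibre (?i v)))"
    by (rule sum.reindex_bij_witness[of _ ?i ?i]) (use i in auto)
  \<comment> \<open>Doubling the sum spares a separate treatment of the fixed points
    \<open>v = 1\<close> and \<open>v = - 1\<close> of inversion.\<close>
  then have "2 * (\<Sum>v\<in>{1..<s}. card (fibre v)) =
      (\<Sum>v\<in>{1..<s}. card (fibre v) + card (fibre (?i v)))"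
    by (simp add: sum.distrib)
  also have "\<dots> = (\<Sum>v\<in>{1..<s}. 2)"
    by (intro sum.cong refl card_fibre_inverse i)
  finally have "int (\<Sum>v\<in>{1..<s}. card (fibre v)) = s - 1" using s_ge_3 by simp
  then show ?thesis using total fibre_0 by linarith
qed

section \<open>Points of 2-power order on the lemniscate\<close>

text \<open>Adding the curve equation to the equation for the second coordinate of
  \<open>2 P\<close> gives \<open>2 * x^2 * (1 + y^2) = 0\<close>, subtracting gives
  \<open>2 * (y^2 - 1) = 0\<close>.\<close>

lemma involutions:
  assumes P: "P \<in> carrier G" and PP: "P \<otimes>\<^bsub>G\<^esub> P = \<one>\<^bsub>G\<^esub>"
  shows "P = (0, 1) \<or> P = (0, s - 1)"
proof -
  obtain x y where xy: "P = (x, y)" by fastforce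
  have on: "on_lemniscate s x y" and range: "x \<in> {0..<s}" "y \<in> {0..<s}"
    using P by (auto simp: xy carrier_iff)
  have "lemniscate_sum s x y x y 0 1"
    using add_sum(1)[OF on on] PP by (simp add: xy one_group)
  then have "s dvd 1 + x * x * y * y - (y * y - x * x)"
    by (simp add: lemniscate_sum_def cong_iff_dvd_diff)
  then have "s dvd (1 + x * x * y * y - (y * y - x * x)) + (x^2 * y^2 + x^2 + y^2 - 1)"
    and d: "s dvd (x^2 * y^2 + x^2 + y^2 - 1) - (1 + x * x * y * y - (y * y - x * x))"
    using on unfolding on_lemniscate_def by (blast intro: dvd_add dvd_diff)+
  then have "s dvd 2 * (x^2 * (1 + y^2))"
    by (simp add: algebra_simps power2_eq_square)
  then have "s dvd x"
    using not_dvd_2 not_dvd_one_plus_square dvd_mult_iff dvd_power2_iff by blast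
  then have "x = 0" using range(1) zdvd_not_zless[of x s] by (cases "x = 0") auto
  have "s dvd 2 * ((y - 1) * (y + 1))"
    using d by (simp add: \<open>x = 0\<close> algebra_simps power2_eq_square)
  then have "s dvd y - 1 \<or> s dvd y + 1" using not_dvd_2 dvd_mult_iff by blast
  then have "y = 1 \<or> y = s - 1"
  proof
    assume "s dvd y - 1"
    then have "[y = 1] (mod s)" by (simp add: cong_iff_dvd_diff)
    then show ?thesis using range s_ge_3 cong_less_imp_eq_int[of y s 1] by simp
  next
    assume "s dvd y + 1"
    then show ?thesis using range zdvd_imp_le[of s "y + 1"] by simp
  qed
  then show ?thesis by (auto simp: xy \<open>x = 0\<close>)
qed

text \<open>For an element of order \<open>2 ^ Suc j\<close>, the \<open>2 ^ j\<close>-th multiple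
  is a non-trivial involution, and \<open>(0, s - 1)\<close> is the only one.\<close>

lemma exists_point_of_order_2_power:
  assumes "2 ^ Suc j dvd s + 1"
  obtains P where "P \<in> carrier G" "P [^]\<^bsub>G\<^esub> (2 ^ j :: nat) = (0, s - 1)"
proof -
  interpret comm_group G by (rule comm_group_G)
  have "card {P \<in> carrier G. P \<otimes>\<^bsub>G\<^esub> P = \<one>\<^bsub>G\<^esub>} \<le> card {(0 :: int, 1), (0, s - 1)}"
    using involutions by (intro card_mono) auto
  also have "\<dots> \<le> 2" by (simp add: card_insert_if)
  finally have K: "card {P \<in> carrier G. P \<otimes>\<^bsub>G\<^esub> P = \<one>\<^bsub>G\<^esub>} \<le> 2" .
  have "int (2 ^ Suc j) dvd int (order G)" using assms by (simp add: order_G)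
  then have "2 ^ Suc j dvd order G" by (simp only: int_dvd_int_iff)
  then obtain P where P: "P \<in> carrier G" "P [^]\<^bsub>G\<^esub> (2 ^ Suc j :: nat) = \<one>\<^bsub>G\<^esub>"
      "P [^]\<^bsub>G\<^esub> (2 ^ j :: nat) \<noteq> \<one>\<^bsub>G\<^esub>"
    using exists_order_2_power[OF finite_carrier K] by blast
  have "P [^]\<^bsub>G\<^esub> (2 ^ j :: nat) \<otimes>\<^bsub>G\<^esub> P [^]\<^bsub>G\<^esub> (2 ^ j :: nat) = \<one>\<^bsub>G\<^esub>"
    using P by (simp add: nat_pow_mult mult_2)
  then have "P [^]\<^bsub>G\<^esub> (2 ^ j :: nat) = (0, s - 1)"
    using involutions P one_group by (metis nat_pow_closed)
  then show ?thesis using that P by blast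
qed

section \<open>Doubling on the cubic and on the lemniscate\<close>

lemma lemniscate_mod_s:
  assumes "on_lemniscate s x y"
  shows "on_lemniscate s (x mod s) (y mod s)"
proof -
  have "[(x mod s)^2 * (y mod s)^2 + (x mod s)^2 + (y mod s)^2 - 1 = x^2 * y^2 + x^2 + y^2 - 1] (mod s)"
    by (intro cong_add cong_diff cong_mult cong_pow cong_refl) (simp_all add: cong_def)
  then show ?thesis using assms by (simp add: on_lemniscate_def cong_dvd_iff)
qed

lemma order_two_square: "(0, s - 1) \<otimes>\<^bsub>G\<^esub> (0, s - 1) = \<one>\<^bsub>G\<^esub>"
proof -
  have "(s - 1) * (s - 1) = 1 + s * (s - 2)" by (simp add: algebra_simps)
  then have "(s - 1) * (s - 1) mod s = 1" using s_ge_3 by (simp only: mod_mult_self2) simp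
  then show ?thesis
    using s_ge_3 by (simp add: lemniscate_group_def lemniscate_add_def)
qed

text \<open>The curve equation at \<open>v = - 1\<close> forces \<open>u = 0\<close>. So the second
  coordinate alone, the one seen by \<open>x\<close> on the cubic, detects the point of order
  two.\<close>

lemma eq_order_two_iff:
  assumes P: "(u, v) \<in> carrier G"
  shows "(u, v) = (0, s - 1) \<longleftrightarrow> s dvd 1 + v"
proof
  assume v: "s dvd 1 + v"
  then have "v = s - 1" using P zdvd_imp_le[of s "1 + v"] by (auto simp: carrier_iff)
  have "[u^2 * (1 + v^2) = (1 + v) * (1 - v)] (mod s)"
    using P by (simp add: carrier_iff on_lemniscate_iff algebra_simps power2_eq_square)
  moreover have "s dvd (1 + v) * (1 - v)" using v by simp
  ultimately have "s dvd u^2 * (1 + v^2)" by (simp add: cong_dvd_iff)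
  then have "s dvd u" using not_dvd_one_plus_square dvd_mult_iff dvd_power2_iff by blast
  then have "u = 0" using P zdvd_not_zless[of u s] by (cases "u = 0") (auto simp: carrier_iff)
  with \<open>v = s - 1\<close> show "(u, v) = (0, s - 1)" by simp
qed auto

lemma dvd_one_minus:
  assumes P: "(u, v) \<in> carrier G" and v: "s dvd 1 - v"
  shows "(u, v) = \<one>\<^bsub>G\<^esub>"
proof -
  have "[u^2 * (1 + v^2) = (1 - v) * (1 + v)] (mod s)"
    using P by (simp add: carrier_iff on_lemniscate_iff algebra_simps power2_eq_square)
  moreover have "s dvd (1 - v) * (1 + v)" using v by simp
  ultimately have "s dvd u^2 * (1 + v^2)" by (simp add: cong_dvd_iff)
  then have "s dvd u" using not_dvd_one_plus_square dvd_mult_iff dvd_power2_iff by blast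
  then have "[u = 0] (mod s)" "[v = 1] (mod s)"
    using v by (simp_all add: cong_iff_dvd_diff dvd_diff_commute)
  moreover have "(0, 1) \<in> carrier G"
    using s_ge_3 by (simp add: carrier_iff on_lemniscate_def)
  ultimately show ?thesis unfolding one_group by (intro carrier_eqI[OF P])
qed

section \<open>Correspondence of the two doubling maps\<close>

lemma dvd_dbl_denom_iff: "s dvd dbl_denom m x \<longleftrightarrow> s dvd x \<or> s dvd x^2 - m"
proof -
  have "\<not> s dvd 4" using not_dvd_2 dvd_mult_iff[of 2 2] by simp
  then show ?thesis unfolding dbl_denom_eq dvd_mult_iff by simp
qed

text \<open>
  For \<open>m = - c\<^sup>2\<close> and \<open>2 c = w\<^sup>2\<close>, the map \<open>(x, y) \<mapsto> (w x / y, (x - c) / (x + c))\<close> sends the curve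
  \<open>y\<^sup>2 = x\<^sup>3 - m x\<close> to the lemniscate; the next relation is its second coordinate.
\<close>

definition moebius_rel :: "int \<Rightarrow> int \<Rightarrow> int \<Rightarrow> bool" where
  "moebius_rel c x v \<longleftrightarrow> [x * (1 - v) = c * (1 + v)] (mod s)"

text \<open>The value \<open>v = 1\<close> belongs to the point at infinity of the cubic, which has
  no \<open>x\<close>.\<close>

lemma moebius_rel_not_one:
  assumes c: "\<not> s dvd c" and rel: "moebius_rel c x v"
  shows "\<not> s dvd 1 - v"
proof
  assume v: "s dvd 1 - v"
  then have "s dvd c * (1 + v)"
    using rel unfolding moebius_rel_def by (metis cong_dvd_iff dvd_mult)
  then have "s dvd 1 + v" using c dvd_mult_iff by blast
  with v have "s dvd (1 - v) + (1 + v)" by (rule dvd_add)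
  then show False using not_dvd_2 by simp
qed

text \<open>The point \<open>(0, 0)\<close> of the cubic corresponds to the point of order two; this
  turns a vanishing \<open>x\<close> into a statement about orders.\<close>

lemma moebius_rel_zero_iff:
  assumes c: "\<not> s dvd c" and rel: "moebius_rel c x v"
  shows "s dvd x \<longleftrightarrow> s dvd 1 + v"
  using cong_dvd_iff[OF rel[unfolded moebius_rel_def]] moebius_rel_not_one[OF assms] c
  by (simp add: dvd_mult_iff)

text \<open>With \<open>m = - (c^2)\<close>, doubling reads
  \<open>x' = (x^2 - c^2)^2 / (4 * x * (x^2 + c^2))\<close>. Facts \<open>e1\<close> and
  \<open>e2\<close> express its numerator and denominator through \<open>v\<close>;
  \<open>e3\<close> and \<open>e4\<close> do so for \<open>1 - v'\<close> and \<open>1 + v'\<close>,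
  eliminating \<open>u\<close> by the curve equation. The claim follows after cancelling a
  unit.\<close>

lemma moebius_rel_double:
  assumes P: "(u, v) \<in> carrier G" and PP: "(u, v) \<otimes>\<^bsub>G\<^esub> (u, v) = (u', v')"
    and c: "\<not> s dvd c" "[c^2 = - m] (mod s)" and rel: "moebius_rel c x v" and x: "\<not> s dvd x"
    and x': "[x' * dbl_denom m x = x^4 + 2 * m * x^2 + m^2] (mod s)"
  shows "moebius_rel c x' v'"
proof -
  have on: "on_lemniscate s u v" using P by (simp add: carrier_iff)
  have v'K: "[v' * (1 + u * u * v * v) = v * v - u * u] (mod s)"
    using add_sum(1)[OF on on PP] by (simp add: lemniscate_sum_def)
  define K where "K = 1 + u * u * v * v"
  have K: "\<not> s dvd K" using denominators_nonzero(2)[OF on on] by (simp add: K_def)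
  define D where "D = 4 * (x * (x^2 + c^2))"
  have m: "[m = - (c^2)] (mod s)"
    using c(2) cong_minus_minus_iff[of "c^2" "- m" s] by (simp add: cong_sym_eq)
  have "[4 * (x * (x^2 - m)) = 4 * (x * (x^2 - - (c^2)))] (mod s)"
    by (intro cong_mult cong_diff cong_refl m)
  then have "[dbl_denom m x = D] (mod s)"
    by (simp add: dbl_denom_def D_def algebra_simps power3_eq_cube power2_eq_square)
  then have "[x' * D = x' * dbl_denom m x] (mod s)"
    by (intro cong_mult cong_refl) (rule cong_sym)
  also note x'
  also have "x^4 + 2 * m * x^2 + m^2 = (x^2 + m)^2"
    by (simp add: algebra_simps power2_eq_square power4_eq_xxxx)
  also have "[(x^2 + m)^2 = (x^2 + - (c^2))^2] (mod s)"
    by (intro cong_pow cong_add cong_refl m)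
  finally have x'D: "[x' * D = (x^2 - c^2)^2] (mod s)" by simp
  have v1: "\<not> s dvd 1 - v" using moebius_rel_not_one[OF c(1) rel] .
  have xc: "\<not> s dvd x^2 + c^2" using sum_squares_dvd(2) c(1) by blast
  have "\<not> s dvd 4" using not_dvd_2 dvd_mult_iff[of 2 2] by simp
  then have D: "\<not> s dvd D" using x xc unfolding D_def dvd_mult_iff by simp
  note rel = rel[unfolded moebius_rel_def]
  have "[((x * (1 - v))^2 - c^2 * (1 - v)^2)^2 = ((c * (1 + v))^2 - c^2 * (1 - v)^2)^2] (mod s)"
    by (intro cong_pow cong_diff cong_refl rel)
  also have "((x * (1 - v))^2 - c^2 * (1 - v)^2)^2 = (x^2 - c^2)^2 * (1 - v)^4"
    by (simp add: algebra_simps power2_eq_square power4_eq_xxxx)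
  also have "((c * (1 + v))^2 - c^2 * (1 - v)^2)^2 = 16 * v^2 * c^4"
    by (simp add: algebra_simps power2_eq_square power4_eq_xxxx)
  finally have e1: "[(x^2 - c^2)^2 * (1 - v)^4 = 16 * v^2 * c^4] (mod s)" .
  have "[(x * (1 - v)) * ((x * (1 - v))^2 + c^2 * (1 - v)^2)
      = (c * (1 + v)) * ((c * (1 + v))^2 + c^2 * (1 - v)^2)] (mod s)"
    by (intro cong_pow cong_add cong_mult cong_refl rel)
  also have "(x * (1 - v)) * ((x * (1 - v))^2 + c^2 * (1 - v)^2) = x * (x^2 + c^2) * (1 - v)^3"
    by (simp add: algebra_simps power2_eq_square power3_eq_cube)
  also have "(c * (1 + v)) * ((c * (1 + v))^2 + c^2 * (1 - v)^2) = 2 * c^3 * (1 + v) * (1 + v^2)"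
    by (simp add: algebra_simps power2_eq_square power3_eq_cube)
  finally have e2: "[x * (x^2 + c^2) * (1 - v)^3 = 2 * c^3 * (1 + v) * (1 + v^2)] (mod s)" .
  have curve: "s dvd u^2 * v^2 + u^2 + v^2 - 1" using on by (simp add: on_lemniscate_def)
  have "[K - v' * K = K - (v * v - u * u)] (mod s)"
    using v'K unfolding K_def by (intro cong_diff cong_refl)
  moreover have "[K - (v * v - u * u) = 2 - 2 * v^2] (mod s)"
    using curve by (simp add: cong_iff_dvd_diff K_def algebra_simps power2_eq_square)
  ultimately have e3: "[(1 - v') * K = 2 - 2 * v^2] (mod s)"
    by (metis cong_trans left_diff_distrib mult_1)
  have "[K + v' * K = K + (v * v - u * u)] (mod s)"
    using v'K unfolding K_def by (intro cong_add cong_refl)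
  then have "[(1 + v') * K * (1 + v^2) = (K + (v * v - u * u)) * (1 + v^2)] (mod s)"
    by (intro cong_mult cong_refl) (simp add: distrib_right)
  moreover have "(K + (v * v - u * u)) * (1 + v^2) - 4 * v^2 =
      (u^2 * v^2 + u^2 + v^2 - 1) * (v^2 - 1)"
    unfolding K_def by (simp add: algebra_simps power2_eq_square)
  then have "[(K + (v * v - u * u)) * (1 + v^2) = 4 * v^2] (mod s)"
    using curve by (simp add: cong_iff_dvd_diff)
  ultimately have e4: "[(1 + v') * K * (1 + v^2) = 4 * v^2] (mod s)" by (rule cong_trans)
  have "x' * (1 - v') * (K * (1 + v^2) * D * (1 - v)^4) =
      (x' * D) * (1 - v)^4 * ((1 - v') * K) * (1 + v^2)"
    by (simp add: mult_ac)
  also have "[\<dots> = (x^2 - c^2)^2 * (1 - v)^4 * (2 - 2 * v^2) * (1 + v^2)] (mod s)"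
    by (intro cong_mult cong_refl x'D e3)
  also have "[(x^2 - c^2)^2 * (1 - v)^4 * (2 - 2 * v^2) * (1 + v^2) =
      16 * v^2 * c^4 * (2 - 2 * v^2) * (1 + v^2)] (mod s)"
    by (intro cong_mult cong_refl e1)
  also have "16 * v^2 * c^4 * (2 - 2 * v^2) * (1 + v^2) =
      4 * c * (1 - v) * (2 * c^3 * (1 + v) * (1 + v^2)) * (4 * v^2)"
    by (simp add: algebra_simps power2_eq_square power3_eq_cube power4_eq_xxxx)
  also have "[\<dots> = 4 * c * (1 - v) * (x * (x^2 + c^2) * (1 - v)^3) * ((1 + v') * K * (1 + v^2))] (mod s)"
    by (intro cong_mult cong_refl cong_sym[OF e2] cong_sym[OF e4])
  also have "4 * c * (1 - v) * (x * (x^2 + c^2) * (1 - v)^3) * ((1 + v') * K * (1 + v^2)) =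
      c * (1 + v') * (K * (1 + v^2) * D * ((1 - v) * (1 - v)^3))"
    by (simp only: D_def mult_ac)
  also have "(1 - v) * (1 - v)^3 = (1 - v)^4" by (simp add: power4_eq_xxxx power3_eq_cube)
  finally have "[x' * (1 - v') * (K * (1 + v^2) * D * (1 - v)^4) =
      c * (1 + v') * (K * (1 + v^2) * D * (1 - v)^4)] (mod s)" .
  moreover have "\<not> s dvd K * (1 + v^2) * D * (1 - v)^4"
    using K D v1 not_dvd_one_plus_square[of v] by (simp add: dvd_mult_iff power4_eq_xxxx)
  ultimately show ?thesis
    unfolding moebius_rel_def by (rule cong_cancel[rotated])
qed

lemma pow_2_Suc:
  assumes "P \<in> carrier G"
  shows "P [^]\<^bsub>G\<^esub> (2 ^ Suc i :: nat) = P [^]\<^bsub>G\<^esub> (2 ^ i :: nat) \<otimes>\<^bsub>G\<^esub> P [^]\<^bsub>G\<^esub> (2 ^ i :: nat)"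
proof -
  interpret comm_group G by (rule comm_group_G)
  show ?thesis using assms by (simp add: nat_pow_mult mult_2)
qed

lemma moebius_rel_pow_2:
  assumes P: "P \<in> carrier G" and c: "\<not> s dvd c" "[c^2 = - m] (mod s)"
    and rel: "moebius_rel c (x 0) (snd P)" and x: "\<And>j. j < i \<Longrightarrow> \<not> s dvd x j"
    and double: "\<And>j. j < i \<Longrightarrow>
      [x (Suc j) * dbl_denom m (x j) = x j ^ 4 + 2 * m * x j ^ 2 + m ^ 2] (mod s)"
  shows "moebius_rel c (x i) (snd (P [^]\<^bsub>G\<^esub> (2 ^ i :: nat)))"
  using x double
proof (induction i)
  case 0
  interpret comm_group G by (rule comm_group_G)
  show ?case using rel P by simp
next
  case (Suc i)
  interpret comm_group G by (rule comm_group_G)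
  obtain u v where uv: "P [^]\<^bsub>G\<^esub> (2 ^ i :: nat) = (u, v)" by fastforce
  obtain u' v' where uv': "P [^]\<^bsub>G\<^esub> (2 ^ Suc i :: nat) = (u', v')" by fastforce
  have "(u, v) \<in> carrier G" using nat_pow_closed[OF P, of "2 ^ i"] by (simp only: uv)
  moreover have "(u, v) \<otimes>\<^bsub>G\<^esub> (u, v) = (u', v')" using pow_2_Suc[OF P, of i] by (simp only: uv uv')
  moreover have "moebius_rel c (x i) v" using Suc by (simp add: uv)
  ultimately have "moebius_rel c (x (Suc i)) v'"
    using moebius_rel_double[OF _ _ c] Suc.prems(1,2)[of i] by blast
  then show ?case by (simp only: uv' snd_conv)
qed

section \<open>From the doubling sequence to a divisor of \<open>s + 1\<close>\<close>

text \<open>As \<open>m\<close> is a non-residue, \<open>- m\<close> is a square; the sign of its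
  root \<open>c\<close> is chosen so that \<open>2 * c\<close> is a square as well.\<close>

lemma nonresidue_parameters:
  assumes "\<not> QuadRes s m"
  obtains c w where "\<not> s dvd c" "\<not> s dvd w" "[c^2 = - m] (mod s)" "[w^2 = 2 * c] (mod s)"
proof -
  obtain c0 where c0: "[c0^2 = - m] (mod s)"
    using square_or_minus_square[of m] assms by (auto simp: QuadRes_def)
  have nz: "\<not> s dvd c" if "[c^2 = - m] (mod s)" for c
  proof
    assume "s dvd c"
    then have "s dvd - m" using that by (metis cong_dvd_iff dvd_power2_iff)
    then have "[0^2 = m] (mod s)" by (simp add: cong_iff_dvd_diff)
    then show False using assms unfolding QuadRes_def by blast
  qed
  obtain w where w: "[w^2 = 2 * c0] (mod s) \<or> [w^2 = - (2 * c0)] (mod s)"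
    using square_or_minus_square by blast
  define c where "c = (if [w^2 = 2 * c0] (mod s) then c0 else - c0)"
  have c: "[c^2 = - m] (mod s)" "[w^2 = 2 * c] (mod s)" using c0 w by (auto simp: c_def)
  have "\<not> s dvd 2 * c" using nz[OF c(1)] not_dvd_2 dvd_mult_iff by blast
  then have "\<not> s dvd w" using c(2) by (metis cong_dvd_iff dvd_power2_iff)
  then show ?thesis using that nz c by blast
qed

text \<open>The image of the starting point on the lemniscate has the point of order two as its
  \<open>2 ^ k\<close>-th multiple, hence has order \<open>2 ^ Suc k\<close>, which divides the
  group order. The sequence is arbitrary so that its image under an isogeny can be inserted
  too.\<close>

lemma power_of_2_dvd_succ_nonresidue:
  assumes m: "\<not> QuadRes s m" and k: "k > 0"
    and y: "[y^2 = x 0 ^ 3 - m * x 0] (mod s)"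
    and x: "\<And>i. i < k \<Longrightarrow> \<not> s dvd x i"
    and double: "\<And>i. i < k \<Longrightarrow>
      [x (Suc i) * dbl_denom m (x i) = x i ^ 4 + 2 * m * x i ^ 2 + m ^ 2] (mod s)"
    and xk: "s dvd x k"
  shows "2 ^ Suc k dvd s + 1"
proof -
  obtain c w where c: "\<not> s dvd c" and w: "\<not> s dvd w" and cm: "[c^2 = - m] (mod s)"
    and wc: "[w^2 = 2 * c] (mod s)"
    using nonresidue_parameters[OF m] by blast
  define a where "a = x 0"
  have a: "\<not> s dvd a" using x[OF k] by (simp add: a_def)
  have "[a^3 + a * (- m) = a^3 + a * c^2] (mod s)"
    by (intro cong_add cong_mult cong_refl cong_sym[OF cm])
  then have y2: "[y^2 = a^3 + a * c^2] (mod s)"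
    using y cong_trans by (fastforce simp: a_def mult.commute)
  have "\<not> s dvd a * (a^2 + c^2)"
    using a sum_squares_dvd(1)[of a c] by (auto simp: dvd_mult_iff)
  then have "\<not> s dvd a^3 + a * c^2"
    by (simp add: algebra_simps power2_eq_square power3_eq_cube)
  then have sy: "\<not> s dvd y" using y2 by (metis cong_dvd_iff dvd_power2_iff)
  \<comment> \<open>At \<open>a = - c\<close> the cubic gives
    \<open>y^2 = - 2 * c^3 = - ((w * c)^2)\<close>, impossible as \<open>- 1\<close> is a
    non-square.\<close>
  have ac: "\<not> s dvd a + c"
  proof
    assume s: "s dvd a + c"
    have "a^3 + a * c^2 + 2 * c * c^2 = (a + c) * (a^2 - a * c + 2 * c^2)"
      by (simp add: algebra_simps power2_eq_square power3_eq_cube)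
    then have "s dvd a^3 + a * c^2 + 2 * c * c^2" using s by simp
    moreover have "[y^2 + w^2 * c^2 = a^3 + a * c^2 + 2 * c * c^2] (mod s)"
      by (intro cong_add cong_mult cong_refl y2 wc)
    ultimately have "s dvd y^2 + (w * c)^2" by (simp add: cong_dvd_iff power_mult_distrib)
    then show False using sum_squares_dvd(1) sy by blast
  qed
  define u where "u = w * a * modular_inverse s y"
  define v where "v = (a - c) * modular_inverse s (a + c)"
  have u: "[u * y = w * a] (mod s)" and v: "[v * (a + c) = a - c] (mod s)"
    unfolding u_def v_def by (rule cong_inverse[OF sy], rule cong_inverse[OF ac])
  \<comment> \<open>The normalisation \<open>w^2 = 2 * c\<close> is what produces
    \<open>4 * a * c = (a + c)^2 - (a - c)^2\<close>, the numerator of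
    \<open>1 - v^2\<close>.\<close>
  have "u^2 * (1 + v^2) * (y^2 * (a + c)^2) = (u * y)^2 * ((a + c)^2 + (v * (a + c))^2)"
    by (simp add: algebra_simps power2_eq_square)
  also have "[\<dots> = (w * a)^2 * ((a + c)^2 + (a - c)^2)] (mod s)"
    by (intro cong_mult cong_pow cong_add cong_refl u v)
  also have "(w * a)^2 * ((a + c)^2 + (a - c)^2) = w^2 * (2 * a * (a^3 + a * c^2))"
    by (simp add: algebra_simps power2_eq_square power3_eq_cube)
  also have "[\<dots> = 2 * c * (2 * a * y^2)] (mod s)"
    by (intro cong_mult cong_refl wc cong_sym[OF y2])
  also have "2 * c * (2 * a * y^2) = ((a + c)^2 - (a - c)^2) * y^2"
    by (simp add: algebra_simps power2_eq_square)
  also have "[\<dots> = ((a + c)^2 - (v * (a + c))^2) * y^2] (mod s)"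
    by (intro cong_mult cong_diff cong_pow cong_refl cong_sym[OF v])
  also have "((a + c)^2 - (v * (a + c))^2) * y^2 = (1 - v^2) * (y^2 * (a + c)^2)"
    by (simp add: algebra_simps power2_eq_square)
  finally have "[u^2 * (1 + v^2) * (y^2 * (a + c)^2) = (1 - v^2) * (y^2 * (a + c)^2)] (mod s)" .
  moreover have "\<not> s dvd y^2 * (a + c)^2" using sy ac by (simp add: dvd_mult_iff dvd_power2_iff)
  ultimately have on: "on_lemniscate s u v"
    unfolding on_lemniscate_iff by (rule cong_cancel[rotated])
  define P where "P = (u mod s, v mod s)"
  have P: "P \<in> carrier G" using lemniscate_mod_s[OF on] by (simp add: P_def carrier_iff)
  have "[a * (1 - v) * (a + c) = c * (1 + v) * (a + c)] (mod s)"
  proof -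
    have "a * (1 - v) * (a + c) = a * ((a + c) - v * (a + c))" by (simp add: algebra_simps)
    also have "[\<dots> = a * ((a + c) - (a - c))] (mod s)"
      by (intro cong_mult cong_diff cong_refl v)
    also have "a * ((a + c) - (a - c)) = c * ((a + c) + (a - c))" by (simp add: algebra_simps)
    also have "[\<dots> = c * ((a + c) + v * (a + c))] (mod s)"
      by (intro cong_mult cong_add cong_refl cong_sym[OF v])
    also have "c * ((a + c) + v * (a + c)) = c * (1 + v) * (a + c)" by (simp add: algebra_simps)
    finally show ?thesis .
  qed
  then have "[a * (1 - v) = c * (1 + v)] (mod s)" by (rule cong_cancel[OF ac])
  moreover have "[a * (1 - v mod s) = a * (1 - v)] (mod s)" "[c * (1 + v) = c * (1 + v mod s)] (mod s)"
    by (intro cong_mult cong_add cong_diff cong_refl; simp add: cong_def)+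
  ultimately have "moebius_rel c (x 0) (snd P)"
    unfolding moebius_rel_def P_def a_def[symmetric] snd_conv by (meson cong_trans)
  then have rel: "moebius_rel c (x k) (snd (P [^]\<^bsub>G\<^esub> (2 ^ k :: nat)))"
    using x double by (intro moebius_rel_pow_2[OF P c cm]) auto
  interpret comm_group G by (rule comm_group_G)
  obtain u' v' where uv': "P [^]\<^bsub>G\<^esub> (2 ^ k :: nat) = (u', v')" by fastforce
  have "(u', v') \<in> carrier G" using nat_pow_closed[OF P, of "2 ^ k"] by (simp only: uv')
  moreover have "s dvd 1 + v'" using moebius_rel_zero_iff[OF c rel] xk by (simp add: uv')
  ultimately have pow: "P [^]\<^bsub>G\<^esub> (2 ^ k :: nat) = (0, s - 1)"
    using eq_order_two_iff uv' by metis
  then have "P [^]\<^bsub>G\<^esub> (2 ^ Suc k :: nat) = \<one>\<^bsub>G\<^esub>"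
    using pow_2_Suc[OF P, of k] order_two_square by simp
  then have "ord P dvd 2 ^ Suc k" using pow_eq_id[OF P] by simp
  then obtain i where i: "i \<le> Suc k" "ord P = 2 ^ i"
    using divides_primepow_nat[of 2 "ord P" "Suc k"] by auto
  have "P [^]\<^bsub>G\<^esub> (2 ^ k :: nat) \<noteq> \<one>\<^bsub>G\<^esub>" using s_ge_3 by (simp add: pow one_group)
  then have "\<not> ord P dvd 2 ^ k" using pow_eq_id[OF P] by simp
  then have "\<not> i \<le> k" using i(2) by (auto simp: le_imp_power_dvd)
  then have "ord P = 2 ^ Suc k" using i by (simp add: le_Suc_eq)
  then have "2 ^ Suc k dvd order G" using ord_dvd_group_order[OF P] by simp
  then have "int (2 ^ Suc k) dvd int (order G)" by (simp only: int_dvd_int_iff)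
  then show ?thesis by (simp add: order_G)
qed

text \<open>
  If \<open>m\<close> is a residue, pass to \<open>y\<^sup>2 = x\<^sup>3 + 4 m x\<close> by the \<open>2\<close>-isogeny
  \<open>(x, y) \<mapsto> ((x\<^sup>2 - m) / x, y (x\<^sup>2 + m) / x\<^sup>2)\<close>.
\<close>

lemma power_of_2_dvd_succ:
  assumes m: "\<not> s dvd m" and k: "k > 0"
    and y: "[y^2 = x 0 ^ 3 - m * x 0] (mod s)"
    and denom: "\<And>i. i < k \<Longrightarrow> \<not> s dvd dbl_denom m (x i)"
    and double: "\<And>i. i < k \<Longrightarrow>
      [x (Suc i) * dbl_denom m (x i) = x i ^ 4 + 2 * m * x i ^ 2 + m ^ 2] (mod s)"
    and last: "s dvd dbl_denom m (x k)"
  shows "2 ^ Suc k dvd s + 1"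
proof (cases "QuadRes s m")
  case False
  have "\<not> s dvd x k ^ 2 - m"
    using False unfolding QuadRes_def cong_iff_dvd_diff by blast
  then have "s dvd x k" using last by (simp add: dvd_dbl_denom_iff)
  moreover have "\<not> s dvd x i" if "i < k" for i
    using denom[OF that] by (simp add: dvd_dbl_denom_iff)
  ultimately show ?thesis using power_of_2_dvd_succ_nonresidue[where x = x, OF False k y] double by blast
next
  case True
  then obtain t where t: "[t^2 = m] (mod s)" by (auto simp: QuadRes_def)
  have st: "\<not> s dvd t" using t m by (metis cong_dvd_iff dvd_power2_iff)
  have num_eq: "b^4 + 2 * m * b^2 + m^2 = (b^2 + m)^2" for b
    by (simp add: algebra_simps power2_eq_square power4_eq_xxxx)
  have plus: "\<not> s dvd b^2 + m" for b
  proof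
    assume "s dvd b^2 + m"
    moreover have "[b^2 + t^2 = b^2 + m] (mod s)" by (intro cong_add cong_refl t)
    ultimately have "s dvd b^2 + t^2" by (simp add: cong_dvd_iff)
    then show False using sum_squares_dvd(2) st by blast
  qed
  \<comment> \<open>At index \<open>k\<close> the reason is different: the numerator of
    \<open>x k\<close> is the square of some \<open>b^2 + m\<close>, a unit because
    \<open>m = t^2\<close>. So the last denominator vanishes through \<open>x k ^ 2 - m\<close>,
    that is, \<open>X k = 0\<close> below.\<close>
  have xi: "\<not> s dvd x i" if "i \<le> k" for i
  proof (cases "i = k")
    case True
    then obtain j where j: "k = Suc j" using k by (cases k) auto
    show ?thesis
    proof
      assume "s dvd x i"
      then have "s dvd x (Suc j) * dbl_denom m (x j)" using True j by simp
      then have "s dvd (x j ^ 2 + m)^2"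
        using double[of j] j by (simp add: cong_dvd_iff num_eq)
      then show False using plus dvd_power2_iff by blast
    qed
  next
    case False
    then show ?thesis using that denom[of i] by (simp add: dvd_dbl_denom_iff)
  qed
  define X where "X i = (x i ^ 2 - m) * modular_inverse s (x i)" for i
  have X: "[X i * x i = x i ^ 2 - m] (mod s)" if "i \<le> k" for i
    unfolding X_def by (rule cong_inverse[OF xi[OF that]])
  define Y where "Y = y * (x 0 ^ 2 + m) * modular_inverse s (x 0 ^ 2)"
  have Y: "[Y * x 0 ^ 2 = y * (x 0 ^ 2 + m)] (mod s)"
    unfolding Y_def using xi[of 0] by (intro cong_inverse) (simp add: dvd_power2_iff)
  \<comment> \<open>The isogenous curve has parameter \<open>- 4 * m\<close>; since
    \<open>4 * m\<close> is a non-zero square, the non-residue case applies to it.\<close>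
  have "\<not> QuadRes s (- 4 * m)"
  proof
    assume "QuadRes s (- 4 * m)"
    then obtain b where "[b^2 = - 4 * m] (mod s)" by (auto simp: QuadRes_def)
    then have "[b^2 + 4 * t^2 = - 4 * m + 4 * m] (mod s)" using t by (intro cong_add cong_mult cong_refl)
    then have "s dvd b^2 + (2 * t)^2" by (simp add: cong_iff_dvd_diff power_mult_distrib)
    then have "s dvd 2 * t" by (rule sum_squares_dvd(2))
    then show False using st not_dvd_2 dvd_mult_iff by blast
  qed
  then show ?thesis
  proof (rule power_of_2_dvd_succ_nonresidue[OF _ k])
    let ?x = "x 0" and ?X = "X 0"
    note X0 = X[of 0, OF le0]
    have "Y^2 * ?x^4 = (Y * ?x^2)^2"
      by (simp add: power_mult_distrib flip: power_mult)
    also have "[\<dots> = (y * (?x^2 + m))^2] (mod s)" by (intro cong_pow Y)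
    also have "(y * (?x^2 + m))^2 = y^2 * (?x^2 + m)^2" by (simp add: power_mult_distrib)
    also have "[\<dots> = (?x^3 - m * ?x) * (?x^2 + m)^2] (mod s)" by (intro cong_mult cong_refl y)
    also have "(?x^3 - m * ?x) * (?x^2 + m)^2 = ?x * ((?x^2 - m)^3 + 4 * m * ?x^2 * (?x^2 - m))"
      by (simp add: algebra_simps power2_eq_square power3_eq_cube)
    also have "[\<dots> = ?x * ((?X * ?x)^3 + 4 * m * ?x^2 * (?X * ?x))] (mod s)"
      by (intro cong_mult cong_add cong_pow cong_refl cong_sym[OF X0])
    also have "?x * ((?X * ?x)^3 + 4 * m * ?x^2 * (?X * ?x)) = (?X^3 - - 4 * m * ?X) * ?x^4"
      by (simp add: algebra_simps power2_eq_square power3_eq_cube power4_eq_xxxx)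
    finally show "[Y^2 = ?X^3 - - 4 * m * ?X] (mod s)"
      using cong_cancel[of "?x^4"] xi[of 0] by (simp add: power4_eq_xxxx dvd_mult_iff)
  next
    fix i assume i: "i < k"
    have "\<not> s dvd x i ^ 2 - m" using denom[OF i] by (simp add: dvd_dbl_denom_iff)
    then show "\<not> s dvd X i"
      using X[of i] i by (metis cong_dvd_iff dvd_mult2 less_imp_le)
  next
    have "s dvd x k ^ 2 - m" using last xi[of k] by (simp add: dvd_dbl_denom_iff)
    then have "s dvd X k * x k" using X[of k] by (simp add: cong_dvd_iff)
    then show "s dvd X k" using xi[of k] dvd_mult_iff by blast
  next
    fix i assume i: "i < k"
    let ?x = "x i" and ?X = "X i" and ?x' = "x (Suc i)" and ?X' = "X (Suc i)"
    define D where "D = dbl_denom m ?x"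
    note Xi = X[of i, OF less_imp_le[OF i]] and Xi' = X[of "Suc i", OF Suc_leI[OF i]]
    have D: "[?x' * D = (?x^2 + m)^2] (mod s)" using double[OF i] by (simp add: num_eq D_def)
    \<comment> \<open>The isogeny commutes with doubling; the factor \<open>?x^4 * ?x' * D^2\<close>
      clears all denominators and is a unit.\<close>
    have "?X' * dbl_denom (- 4 * m) ?X * (?x^4 * ?x' * D^2) =
        4 * ((?X' * ?x') * D^2) * (?X * ?x) * ((?X * ?x)^2 + 4 * m * ?x^2) * ?x"
      by (simp add: dbl_denom_def algebra_simps power2_eq_square power3_eq_cube power4_eq_xxxx)
    also have "[\<dots> = 4 * ((?x'^2 - m) * D^2) * (?x^2 - m) * ((?x^2 - m)^2 + 4 * m * ?x^2) * ?x] (mod s)"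
      by (intro cong_mult cong_add cong_pow cong_refl Xi Xi')
    also have "4 * ((?x'^2 - m) * D^2) * (?x^2 - m) * ((?x^2 - m)^2 + 4 * m * ?x^2) * ?x =
        ((?x' * D)^2 - m * D^2) * D * (?x^2 + m)^2"
    proof -
      have "(?x^2 - m)^2 + 4 * m * ?x^2 = (?x^2 + m)^2"
        by (simp add: algebra_simps power2_eq_square)
      moreover have "(?x'^2 - m) * D^2 = (?x' * D)^2 - m * D^2"
        by (simp add: algebra_simps power2_eq_square)
      ultimately show ?thesis unfolding D_def dbl_denom_eq by (simp only: mult_ac)
    qed
    also have "[\<dots> = (((?x^2 + m)^2)^2 - m * D^2) * D * (?x' * D)] (mod s)"
      by (intro cong_mult cong_diff cong_pow cong_refl D cong_sym[OF D])
    \<comment> \<open>With \<open>A = ?x^2 - m\<close> and \<open>B = 4 * m * ?x^2\<close>, one has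
      \<open>(?x^2 + m)^2 = A^2 + B\<close> and \<open>m * D^2 = 4 * A^2 * B\<close>, so the
      difference is \<open>(A^2 - B)^2\<close>.\<close>
    also have "((?x^2 + m)^2)^2 - m * D^2 = ((?x^2 - m)^2 - 4 * m * ?x^2)^2"
      unfolding D_def dbl_denom_eq by (simp add: algebra_simps power2_eq_square)
    also have "((?x^2 - m)^2 - 4 * m * ?x^2)^2 * D * (?x' * D) =
        ((?x^2 - m)^2 + (- 4 * m) * ?x^2)^2 * (?x' * D^2)"
      by (simp add: power2_eq_square mult_ac)
    also have "[\<dots> = ((?X * ?x)^2 + (- 4 * m) * ?x^2)^2 * (?x' * D^2)] (mod s)"
      by (intro cong_mult cong_add cong_pow cong_refl cong_sym[OF Xi])
    also have "((?X * ?x)^2 + (- 4 * m) * ?x^2)^2 * (?x' * D^2) =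
        (?X^4 + 2 * (- 4 * m) * ?X^2 + (- 4 * m)^2) * (?x^4 * ?x' * D^2)"
      by (simp add: algebra_simps power2_eq_square power4_eq_xxxx)
    finally have "[?X' * dbl_denom (- 4 * m) ?X * (?x^4 * ?x' * D^2) =
        (?X^4 + 2 * (- 4 * m) * ?X^2 + (- 4 * m)^2) * (?x^4 * ?x' * D^2)] (mod s)" .
    moreover have "\<not> s dvd ?x^4 * ?x' * D^2"
      using xi[of i] xi[of "Suc i"] i denom[OF i] by (simp add: D_def dvd_mult_iff dvd_power2_iff power4_eq_xxxx)
    ultimately show "[?X' * dbl_denom (- 4 * m) ?X =
        ?X^4 + 2 * (- 4 * m) * ?X^2 + (- 4 * m)^2] (mod s)"
      by (rule cong_cancel[rotated])
  qed
qed

section \<open>From a divisor of \<open>s + 1\<close> to a starting point\<close>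

text \<open>A lemniscate point of order \<open>2 ^ Suc k\<close> is carried back by
  \<open>x = c * (1 + v) / (1 - v)\<close> and \<open>y = w * x / u\<close>. Then \<open>x_i\<close>
  vanishes exactly when the \<open>2 ^ i\<close>-th multiple is the point of order two, first at
  \<open>i = k\<close>; since \<open>S_seq\<close> at \<open>Suc i\<close> is built from
  \<open>x_i\<close>, indices shift by one.\<close>

lemma exists_order_2_power_point:
  assumes m: "\<not> QuadRes s m" and k: "k > 0" and dvd: "2 ^ Suc k dvd s + 1"
  shows "\<exists>(x, y) \<in> curve_points s m.
    (\<forall>i\<in>{1..k}. gcd (S_seq s m x i) s = 1) \<and> [S_seq s m x (Suc k) = 0] (mod s)"
proof -
  obtain c w where c: "\<not> s dvd c" and w: "\<not> s dvd w" and cm: "[c^2 = - m] (mod s)"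
    and wc: "[w^2 = 2 * c] (mod s)"
    using nonresidue_parameters[OF m] by blast
  interpret comm_group G by (rule comm_group_G)
  obtain P where P: "P \<in> carrier G" and pow_k: "P [^]\<^bsub>G\<^esub> (2 ^ k :: nat) = (0, s - 1)"
    using exists_point_of_order_2_power[OF dvd] by blast
  have not_order_2: "P [^]\<^bsub>G\<^esub> (2 ^ i :: nat) \<otimes>\<^bsub>G\<^esub> P [^]\<^bsub>G\<^esub> (2 ^ i :: nat) \<noteq> \<one>\<^bsub>G\<^esub>" if "i < k" for i
  proof
    assume "P [^]\<^bsub>G\<^esub> (2 ^ i :: nat) \<otimes>\<^bsub>G\<^esub> P [^]\<^bsub>G\<^esub> (2 ^ i :: nat) = \<one>\<^bsub>G\<^esub>"
    then have "P [^]\<^bsub>G\<^esub> (2 ^ Suc i :: nat) = \<one>\<^bsub>G\<^esub>" using pow_2_Suc[OF P] by simp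
    then have "ord P dvd 2 ^ Suc i" using pow_eq_id[OF P] by simp
    also have "(2 :: nat) ^ Suc i dvd 2 ^ k" using that by (intro le_imp_power_dvd) simp
    finally have "P [^]\<^bsub>G\<^esub> (2 ^ k :: nat) = \<one>\<^bsub>G\<^esub>" using pow_eq_id[OF P] by simp
    then show False using s_ge_3 by (simp add: pow_k one_group)
  qed
  obtain u v where uv: "P = (u, v)" by fastforce
  have on: "[u^2 * (1 + v^2) = 1 - v^2] (mod s)"
    using P by (simp add: uv carrier_iff on_lemniscate_iff)
  \<comment> \<open>As \<open>k > 0\<close>, \<open>P\<close> is neither neutral nor of order two;
    this excludes \<open>v = 1\<close> and \<open>v = - 1\<close>, hence also \<open>u = 0\<close>,
    and permits both divisions below.\<close>
  have PP: "P \<otimes>\<^bsub>G\<^esub> P \<noteq> \<one>\<^bsub>G\<^esub>" using not_order_2[OF k] P by simp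
  have v1: "\<not> s dvd 1 - v" using dvd_one_minus P PP uv by (metis l_one)
  have v2: "\<not> s dvd 1 + v" using eq_order_two_iff[of u v] P PP uv order_two_square by metis
  have "\<not> s dvd (1 - v) * (1 + v)" using v1 v2 dvd_mult_iff by blast
  then have "\<not> s dvd 1 - v^2" by (simp add: algebra_simps power2_eq_square)
  then have su: "\<not> s dvd u" using on by (metis cong_dvd_iff dvd_mult2 dvd_power2_iff)
  have inv: "[b * modular_inverse s d mod s * d = b] (mod s)" if "\<not> s dvd d" for b d
    using cong_inverse[OF that, of b] by (simp add: cong_def mod_mult_left_eq)
  define x where "x = c * (1 + v) * modular_inverse s (1 - v) mod s"
  define y where "y = w * x * modular_inverse s u mod s"
  have x: "[x * (1 - v) = c * (1 + v)] (mod s)" and y: "[y * u = w * x] (mod s)"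
    unfolding x_def y_def by (rule inv[OF v1], rule inv[OF su])
  have xy: "(x, y) \<in> curve_points s m"
  proof -
    have "y^2 * (u^2 * (1 - v)^2 * (1 + v^2)) = (y * u)^2 * (1 - v)^2 * (1 + v^2)"
      by (simp add: power_mult_distrib mult_ac)
    also have "[\<dots> = (w * x)^2 * (1 - v)^2 * (1 + v^2)] (mod s)"
      by (intro cong_mult cong_pow cong_refl y)
    also have "(w * x)^2 * (1 - v)^2 * (1 + v^2) = w^2 * x * (x * (1 - v)) * (1 - v) * (1 + v^2)"
      by (simp add: power2_eq_square mult_ac)
    also have "[\<dots> = 2 * c * x * (c * (1 + v)) * (1 - v) * (1 + v^2)] (mod s)"
      by (intro cong_mult cong_refl wc x)
    also have "2 * c * x * (c * (1 + v)) * (1 - v) * (1 + v^2) = 2 * c^2 * x * (1 + v^2) * (1 - v^2)"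
      by (simp add: algebra_simps power2_eq_square)
    also have "[\<dots> = 2 * c^2 * x * (1 + v^2) * (u^2 * (1 + v^2))] (mod s)"
      by (intro cong_mult cong_refl cong_sym[OF on])
    also have "2 * c^2 * x * (1 + v^2) * (u^2 * (1 + v^2)) =
        x * ((c * (1 + v))^2 + c^2 * (1 - v)^2) * (u^2 * (1 + v^2))"
      by (simp add: algebra_simps power2_eq_square)
    also have "[\<dots> = x * ((x * (1 - v))^2 + (- m) * (1 - v)^2) * (u^2 * (1 + v^2))] (mod s)"
      by (intro cong_mult cong_add cong_pow cong_refl cong_sym[OF x] cm)
    also have "x * ((x * (1 - v))^2 + (- m) * (1 - v)^2) * (u^2 * (1 + v^2)) =
        (x^3 - m * x) * (u^2 * (1 - v)^2 * (1 + v^2))"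
      by (simp add: algebra_simps power2_eq_square power3_eq_cube)
    finally have "[y^2 * (u^2 * (1 - v)^2 * (1 + v^2)) =
        (x^3 - m * x) * (u^2 * (1 - v)^2 * (1 + v^2))] (mod s)" .
    moreover have "\<not> s dvd u^2 * (1 - v)^2 * (1 + v^2)"
      using su v1 not_dvd_one_plus_square by (simp add: dvd_mult_iff dvd_power2_iff)
    ultimately have "[y^2 = x^3 - m * x] (mod s)" by (rule cong_cancel[rotated])
    then show ?thesis by (simp add: curve_points_def x_def y_def)
  qed
  let ?x = "x_seq s m x"
  have "\<not> s dvd b^2 - m" for b using m unfolding QuadRes_def cong_iff_dvd_diff by blast
  then have denom_iff: "s dvd dbl_denom m b \<longleftrightarrow> s dvd b" for b
    by (simp add: dvd_dbl_denom_iff)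
  have rel0: "moebius_rel c (?x 0) (snd P)" using x by (simp add: moebius_rel_def uv)
  have rel: "moebius_rel c (?x i) (snd (P [^]\<^bsub>G\<^esub> (2 ^ i :: nat)))"
    if "\<And>j. j < i \<Longrightarrow> \<not> s dvd ?x j" for i
    using that by (intro moebius_rel_pow_2[where x = ?x, OF P c cm rel0] x_seq_double) (simp_all add: denom_iff coprime_iff)
  have zero_iff: "s dvd ?x i \<longleftrightarrow> P [^]\<^bsub>G\<^esub> (2 ^ i :: nat) = (0, s - 1)"
    if "\<And>j. j < i \<Longrightarrow> \<not> s dvd ?x j" for i
    using moebius_rel_zero_iff[OF c rel[OF that]] nat_pow_closed[OF P, of "2 ^ i"]
      eq_order_two_iff[of "fst (P [^]\<^bsub>G\<^esub> (2 ^ i :: nat))" "snd (P [^]\<^bsub>G\<^esub> (2 ^ i :: nat))"]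
    by simp
  \<comment> \<open>Strong induction, because the correspondence at index \<open>i\<close>
    presupposes that no earlier \<open>x_j\<close> vanishes.\<close>
  have nz: "\<not> s dvd ?x i" if "i < k" for i
    using that
  proof (induction i rule: less_induct)
    case (less i)
    then have "\<not> s dvd ?x j" if "j < i" for j using that by simp
    then show ?case using zero_iff not_order_2[OF less.prems] order_two_square by metis
  qed
  have "gcd (S_seq s m x i) s = 1" if i: "i \<in> {1..k}" for i
  proof -
    obtain j where j: "i = Suc j" "j < k" using i by (cases i) auto
    then have "\<not> s dvd S_seq s m x i" using nz denom_iff by simp
    then show ?thesis using coprime_iff coprime_iff_gcd_eq_1 by blast
  qed
  moreover have "[S_seq s m x (Suc k) = 0] (mod s)"
    using zero_iff[of k] nz pow_k denom_iff by (simp add: cong_0_iff)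
  ultimately show ?thesis using xy by blast
qed

end

section \<open>The primality criterion\<close>

text \<open>If a prime factor is not \<open>3\<close> modulo \<open>4\<close>, its cofactor is, and
  the cofactor is smaller.\<close>

lemma prime_divisor_3_mod_4:
  fixes n :: nat
  assumes "n mod 4 = 3"
  obtains q where "prime q" "q dvd n" "q mod 4 = 3"
proof -
  have "\<exists>q. prime q \<and> q dvd n \<and> q mod 4 = 3"
    using assms
  proof (induction n rule: less_induct)
    case (less n)
    have "n \<noteq> 1" using less.prems by auto
    then obtain q where q: "prime q" "q dvd n" using prime_factor_nat by blast
    obtain r where r: "n = q * r" using q(2) by blast
    have n: "n > 0" using less.prems by (cases n) auto
    have qr: "(q mod 4) * (r mod 4) mod 4 = 3" using less.prems r by (simp add: mod_mult_eq)
    have "q mod 4 < 4" by simp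
    then have "q mod 4 = 0 \<or> q mod 4 = 1 \<or> q mod 4 = 2 \<or> q mod 4 = 3" by linarith
    moreover have "r mod 4 < 4" by simp
    then have "r mod 4 = 0 \<or> r mod 4 = 1 \<or> r mod 4 = 2 \<or> r mod 4 = 3" by linarith
    ultimately have "q mod 4 = 3 \<or> r mod 4 = 3" using qr by auto
    then show ?case
    proof
      assume "r mod 4 = 3"
      moreover have "r < n" using r n prime_gt_1_nat[OF q(1)] by simp
      ultimately obtain q' where "prime q'" "q' dvd r" "q' mod 4 = 3" using less.IH by blast
      then show ?thesis using r by auto
    qed (use q in blast)
  qed
  then show ?thesis using that by blast
qed

theorem theorem4p1:
  fixes lam :: real and p n m :: int and k :: nat
  assumes "lam > 1"
    and "p = 2 ^ k * n - 1"
    and "k \<ge> 2"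
    and "odd n" and "n > 0"
    and "real_of_int n \<le> sqrt (real_of_int p) / lam"
    and "lam * sqrt (real_of_int p) > (real_of_int p powr (1 / 4) + 1) ^ 2"
    and "\<not> QuadRes p m"
  shows "prime p \<longleftrightarrow>
    (\<exists>(x, y) \<in> curve_points p m.
       (\<forall>i \<in> {1..k - 1}. gcd (S_seq p m x i) p = 1) \<and> [S_seq p m x k = 0] (mod p))"
proof -
  \<comment> \<open>\<open>K\<close> is \<open>k - 1\<close>: \<open>S_k\<close> is the denominator
    formed from \<open>x_K\<close>, and the order in question is \<open>2 ^ Suc K\<close>.\<close>
  obtain K where K: "k = Suc K" "K > 0" using assms(3) by (cases k) auto
  obtain j where j: "k = 2 + j" using assms(3) le_Suc_ex by blast
  define t where "t = 2 ^ j * n - 1"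
  have p: "p = 4 * t + 3" by (simp add: t_def assms(2) j power_add)
  then have p4: "p mod 4 = 3" by presburger
  have "2 ^ j * n > 0" using assms(5) by simp
  then have p_pos: "p > 0" by (simp add: p t_def)
  \<comment> \<open>Otherwise \<open>n^2 \<ge> 2 ^ k * n = p + 1\<close>, whereas
    \<open>n \<le> sqrt p / lam\<close> with \<open>lam > 1\<close> gives
    \<open>n^2 \<le> p\<close>.\<close>
  have n_less: "n < 2 ^ k"
  proof (rule ccontr)
    assume "\<not> n < 2 ^ k"
    then have "2 ^ k * n \<le> n * n" using assms(5) by (intro mult_right_mono) auto
    then have "real_of_int p < real_of_int n ^ 2"
      using assms(2) by (simp add: power2_eq_square flip: of_int_mult)
    moreover have "real_of_int n \<le> sqrt (real_of_int p)"
    proof -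
      have "sqrt (real_of_int p) / lam \<le> sqrt (real_of_int p) / 1"
        using assms(1) p_pos by (intro divide_left_mono) auto
      then show ?thesis using assms(6) by simp
    qed
    then have "real_of_int n ^ 2 \<le> sqrt (real_of_int p) ^ 2"
      using assms(5) by (intro power_mono) auto
    ultimately show False using p_pos by simp
  qed
  show ?thesis
  proof
    assume "prime p"
    then interpret prime_3_mod_4 p by unfold_locales (use p4 in auto)
    have "2 ^ Suc K dvd p + 1" by (simp add: assms(2) K)
    then show "\<exists>(x, y) \<in> curve_points p m.
       (\<forall>i \<in> {1..k - 1}. gcd (S_seq p m x i) p = 1) \<and> [S_seq p m x k = 0] (mod p)"
      using exists_order_2_power_point[OF assms(8) K(2)] by (simp add: K)
  next
    assume "\<exists>(x, y) \<in> curve_points p m.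
       (\<forall>i \<in> {1..k - 1}. gcd (S_seq p m x i) p = 1) \<and> [S_seq p m x k = 0] (mod p)"
    then obtain x y where xy: "(x, y) \<in> curve_points p m"
      and gcd: "\<And>i. i \<in> {1..K} \<Longrightarrow> gcd (S_seq p m x i) p = 1" and last: "[S_seq p m x k = 0] (mod p)"
      by (auto simp: K)
    obtain q where q: "prime q" "q dvd nat p" "q mod 4 = 3"
      using prime_divisor_3_mod_4[of "nat p"] p4 p_pos by (metis nat_mod_distrib nat_numeral order_less_imp_le zero_le_numeral)
    define s where "s = int q"
    have sp: "s dvd p" using q(2) p_pos int_dvd_int_iff[of q "nat p"] by (simp add: s_def)
    have "s mod 4 = 3" using q(3) zmod_int[of q 4] by (simp add: s_def)
    then interpret prime_3_mod_4 s using q(1) by unfold_locales (simp_all add: s_def)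
    let ?x = "x_seq p m x"
    have coprime: "coprime (dbl_denom m (?x i)) p" if "i < K" for i
      using gcd[of "Suc i"] that by (simp add: coprime_iff_gcd_eq_1)
    have denom: "\<not> s dvd dbl_denom m (?x i)" if "i < K" for i
      using coprime[OF that] sp not_dvd_1 by (meson coprime_common_divisor dvd_refl)
    have double: "[?x (Suc i) * dbl_denom m (?x i) = ?x i ^ 4 + 2 * m * ?x i ^ 2 + m ^ 2] (mod s)"
      if "i < K" for i
      using x_seq_double[OF coprime[OF that]] sp cong_dvd_modulus by blast
    have last': "s dvd dbl_denom m (?x K)"
      using last sp K by (simp add: cong_0_iff dvd_trans)
    have "[y^2 = ?x 0 ^ 3 - m * ?x 0] (mod s)"
      using xy sp cong_dvd_modulus by (auto simp: curve_points_def)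
    \<comment> \<open>If \<open>m = 0\<close> modulo \<open>s\<close>, then \<open>x_K = 0\<close>,
      and the doubling numerator is the fourth power of the preceding \<open>x\<close>. That value
      would vanish too, against its invertible denominator; a predecessor exists because
      \<open>K > 0\<close>.\<close>
    moreover have "\<not> s dvd m"
    proof
      assume m: "s dvd m"
      obtain i where i: "K = Suc i" using K by (cases K) auto
      have "s dvd ?x K" using last' m by (auto simp: dvd_dbl_denom_iff dvd_diff_left_iff dvd_power2_iff)
      then have "s dvd ?x (Suc i) * dbl_denom m (?x i)" using i by simp
      then have "s dvd ?x i ^ 4 + (2 * m * ?x i ^ 2 + m ^ 2)"
        using cong_dvd_iff[OF double[of i]] i by (simp add: add.assoc)
      moreover have "s dvd 2 * m * ?x i ^ 2 + m ^ 2" using m by (simp add: power2_eq_square)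
      ultimately have "s dvd ?x i ^ 4" by (simp add: dvd_add_left_iff)
      then have "s dvd ?x i" using prime_dvd_power prime_s by blast
      then show False using denom[of i] i by (simp add: dvd_dbl_denom_iff)
    qed
    ultimately have "2 ^ k dvd s + 1"
      using power_of_2_dvd_succ[of m K y ?x] K(2) denom double last' unfolding K(1) by blast
    moreover obtain r where r: "p = s * r" using sp by blast
    moreover have "2 ^ k dvd p + 1" by (simp add: assms(2))
    \<comment> \<open>Since \<open>2 ^ k\<close> divides \<open>p + 1\<close> and
      \<open>s + 1\<close>, it divides \<open>r - 1\<close>.\<close>
    moreover have "p + 1 = (s + 1) * r - (r - 1)" using r by (simp add: algebra_simps)
    ultimately have dvd: "2 ^ k dvd r - 1" by (metis dvd_diff_right_iff dvd_mult2)
    have r_pos: "r > 0" using p_pos r s_pos(1) zero_less_mult_pos by blast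
    have "r = 1"
    proof (rule ccontr)
      assume "r \<noteq> 1"
      then have "2 ^ k \<le> r - 1" using dvd r_pos by (intro zdvd_imp_le) auto
      moreover have "2 ^ k \<le> s + 1"
        using \<open>2 ^ k dvd s + 1\<close> s_ge_3 by (intro zdvd_imp_le) auto
      \<comment> \<open>This gives \<open>p \<ge> 4 ^ k - 1\<close>, while
        \<open>n \<le> 2 ^ k - 1\<close> gives \<open>p \<le> 4 ^ k - 2 ^ k - 1\<close>.\<close>
      ultimately have "(2 ^ k - 1) * (2 ^ k + 1) \<le> s * r"
        using s_ge_3 by (intro mult_mono) auto
      also have "s * r = 2 ^ k * n - 1" using r assms(2) by simp
      also have "2 ^ k * n \<le> 2 ^ k * (2 ^ k - 1)" using n_less by (intro mult_left_mono) auto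
      finally show False by (simp add: algebra_simps)
    qed
    then show "prime p" using r prime_s by simp
  qed
qed

end
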